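(* Let $x:\mathbb{R}^2\to\mathbb{R}^3$, $x=(x_1,x_2,x_3)$, be the Calabi surface parameterized by $(u_1,u_2)\in\mathbb{R}^2$ as $$x_1=\int_0^{u_1}e^{t^2}\,dt,\qquad x_2=\int_0^{u_2}e^{-t^2}\,dt,$$ $$x_3=\int_0^{u_1}\Big(e^{t^2}\int_0^t e^{-s^2}ds\Big)dt+\int_0^{u_2}\Big(e^{-t^2}\int_0^t e^{s^2}ds\Big)dt.$$ Then: (i) $x$ is a Calabi affine maximal surface with complete flat Calabi metric. Furthermore, it is also Euclidean complete, and its Tchebychev vector field has a nonconstant norm. (ii) The type II Calabi product of the Calabi surface $x$ and a point, that is, the map $y:\mathbb{R}\times\mathbb{R}^2\to\mathbb{R}^4$ given by $$y=(y_1,\dots,y_4)=(e^t,\;e^tx_1,\;e^tx_2,\;e^tx_3+te^t),\qquad t\in\mathbb{R},\ (u_1,u_2)\in\mathbb{R}^2,$$ is a centroaffine extremal hypersurface of elliptic type in $\mathbb{R}^4$ with complete flat centroaffine metric, and the norm of its (centroaffine) Tchebychev vector field is nonconstant.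
   Context: Calabi geometry. A Calabi surface is a locally strongly convex immersion $x:M^2\to\mathbb{R}^3$ equipped with the constant transversal field $Y=(0,0,1)$. With $D$ the flat connection of $\mathbb{R}^3$, one writes $D_Xx_*Z=x_*(\nabla_XZ)+G(X,Z)Y$; $G$ (positive definite after choice of orientation) is the Calabi metric and $\nabla$ the induced connection. With $\hat\nabla$ the Levi-Civita connection of $G$, set $A=\nabla-\hat\nabla$ (the Fubini-Pick tensor), and let $T=\frac12\operatorname{tr}_G A$ be the Tchebychev vector field, i.e. $T=\frac12\sum_iA(e_i,e_i)$ for a $G$-orthonormal basis; its norm is taken with respect to $G$. Locally, the surface is a graph $x_3=f(x_1,x_2)$ with $f$ strictly convex and $G=\sum f_{ij}dx_idx_j$. The surface is Calabi affine maximal if $\Delta\ln\det(f_{ij})=0$ ($\Delta$ the Laplacian of $G$), equivalently $\operatorname{tr}(\hat\nabla T)=0$. Euclidean complete means that the Riemannian metric induced on $M$ from a Euclidean metric of the ambient space is complete. Centroaffine geometry. A centroaffine hypersurface is an immersion $y:M^n\to\mathbb{R}^{n+1}$ whose position vector $y$ is everywhere transversal to the tangent space. In the locally strongly convex case, write $D_Xy_*Z=y_*(\nabla_XZ)-\varepsilon\,h(X,Z)\,y$, where $\varepsilon\in\{1,-1\}$ is chosen so that $h$ is positive definite; $h$ is the centroaffine metric, and the hypersurface is of elliptic type if $\varepsilon=1$ and hyperbolic type if $\varepsilon=-1$. With $\hat\nabla$ the Levi-Civita connection of $h$, the difference tensor is $K=\nabla-\hat\nabla$ and the Tchebychev vector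 field is $T=\frac1n\operatorname{tr}_hK$. The hypersurface is centroaffine extremal if it satisfies the Euler-Lagrange equation of the volume functional of $h$, i.e. $\operatorname{tr}(\hat\nabla T)=0$; for a graph $x_{n+1}=f(x_1,\dots,x_n)$ this reads $\Delta\ln\Big(\frac{\det(f_{ij})}{(f-\sum_ix_if_i)^{n+2}}\Big)=0$, $\Delta$ the Laplacian of $h$. *)

theory Defs
  imports "HOL-Analysis.Analysis"
begin

text \<open>
  All manifolds here carry a global chart, so the parameter manifold is a Euclidean space
  \<open>'a\<close> and every tangent space is \<open>'a\<close> itself.  A vector field is a function \<open>'a \<Rightarrow> 'a\<close>,
  a metric \<open>g\<close> sends a point \<open>u\<close> and tangent vectors \<open>v\<close>, \<open>w\<close> to \<open>g u v w\<close>, and a connection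
  sends a vector field \<open>Z\<close>, a point \<open>u\<close> and a tangent vector \<open>v\<close> to the covariant
  derivative of \<open>Z\<close> at \<open>u\<close> in direction \<open>v\<close>.  A tangent vector \<open>w\<close> is extended to the
  constant field \<open>\<lambda>_. w\<close> wherever a tensor is evaluated through vector fields; such
  fields have vanishing Lie brackets.
\<close>

type_synonym 'a metric = "'a \<Rightarrow> 'a \<Rightarrow> 'a \<Rightarrow> real"
type_synonym 'a connection = "('a \<Rightarrow> 'a) \<Rightarrow> 'a \<Rightarrow> 'a \<Rightarrow> 'a"

definition dir_deriv :: "'a::real_normed_vector \<Rightarrow> ('a \<Rightarrow> 'b::real_normed_vector) \<Rightarrow> 'a \<Rightarrow> 'b" where
  "dir_deriv v F u = frechet_derivative F (at u) v"

definition smooth_map :: "('a::euclidean_space \<Rightarrow> 'b::euclidean_space) \<Rightarrow> bool" where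
  "smooth_map F \<longleftrightarrow> (\<forall>vs u. foldr dir_deriv vs F differentiable (at u))"

definition inner_product_form :: "('a::real_vector \<Rightarrow> 'a \<Rightarrow> real) \<Rightarrow> bool" where
  "inner_product_form B \<longleftrightarrow>
     bilinear B \<and> (\<forall>v w. B v w = B w v) \<and> (\<forall>v. v \<noteq> 0 \<longrightarrow> B v v > 0)"


subsection \<open>Riemannian geometry in a global chart\<close>

text \<open>The difference between the Levi-Civita connection and the flat connection of the chart:
  the unique symmetric (torsion-free) field of bilinear maps making \<open>g\<close> parallel.\<close>

definition christoffel :: "'a::euclidean_space metric \<Rightarrow> 'a \<Rightarrow> 'a \<Rightarrow> 'a \<Rightarrow> 'a" where
  "christoffel g u = (THE \<Gamma>. bilinear \<Gamma> \<and> (\<forall>v w. \<Gamma> v w = \<Gamma> w v) \<and>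
     (\<forall>v w z. dir_deriv v (\<lambda>p. g p w z) u = g u (\<Gamma> v w) z + g u w (\<Gamma> v z)))"

definition levi_civita :: "'a::euclidean_space metric \<Rightarrow> 'a connection" where
  "levi_civita g Z u v = dir_deriv v Z u + christoffel g u v (Z u)"

definition curvature :: "'a::euclidean_space metric \<Rightarrow> 'a \<Rightarrow> 'a \<Rightarrow> 'a \<Rightarrow> 'a \<Rightarrow> 'a" where
  "curvature g u v w z =
     levi_civita g (\<lambda>p. levi_civita g (\<lambda>_. z) p w) u v -
     levi_civita g (\<lambda>p. levi_civita g (\<lambda>_. z) p v) u w"

definition flat_metric :: "'a::euclidean_space metric \<Rightarrow> bool" where
  "flat_metric g \<longleftrightarrow> (\<forall>u v w z. curvature g u v w z = 0)"

definition speed :: "'a::euclidean_space metric \<Rightarrow> (real \<Rightarrow> 'a) \<Rightarrow> real \<Rightarrow> real" where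
  "speed g \<gamma> t = (let v = vector_derivative \<gamma> (at t) in sqrt (g (\<gamma> t) v v))"

text \<open>The derivative of a \<^const>\<open>valid_path\<close> may be unbounded near its finitely many exceptional
  points.  Integrability of the speed excludes paths of infinite length, whose length
  integral would otherwise have the value \<open>0\<close>.\<close>

definition riemannian_distance :: "'a::euclidean_space metric \<Rightarrow> 'a \<Rightarrow> 'a \<Rightarrow> real" where
  "riemannian_distance g p q = Inf {integral {0..1} (speed g \<gamma>) |\<gamma>.
     valid_path \<gamma> \<and> speed g \<gamma> integrable_on {0..1} \<and> pathstart \<gamma> = p \<and> pathfinish \<gamma> = q}"

definition complete_metric :: "'a::euclidean_space metric \<Rightarrow> bool" where
  "complete_metric g \<longleftrightarrow>
     (\<forall>s :: nat \<Rightarrow> 'a.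
        (\<forall>e>0. \<exists>N. \<forall>m\<ge>N. \<forall>n\<ge>N. riemannian_distance g (s m) (s n) < e) \<longrightarrow>
        (\<exists>l. (\<lambda>n. riemannian_distance g (s n) l) \<longlonglongrightarrow> 0))"

definition linear_trace :: "('a::euclidean_space \<Rightarrow> 'a) \<Rightarrow> real" where
  "linear_trace L = (\<Sum>b\<in>Basis. L b \<bullet> b)"

definition gradient :: "'a::euclidean_space metric \<Rightarrow> ('a \<Rightarrow> real) \<Rightarrow> 'a \<Rightarrow> 'a" where
  "gradient g \<phi> u = (THE w. \<forall>v. g u w v = dir_deriv v \<phi> u)"

definition divergence :: "'a::euclidean_space metric \<Rightarrow> ('a \<Rightarrow> 'a) \<Rightarrow> 'a \<Rightarrow> real" where
  "divergence g Z u = linear_trace (levi_civita g Z u)"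

definition laplacian :: "'a::euclidean_space metric \<Rightarrow> ('a \<Rightarrow> real) \<Rightarrow> 'a \<Rightarrow> real" where
  "laplacian g \<phi> = divergence g (gradient g \<phi>)"

definition orthonormal_basis :: "('a::euclidean_space \<Rightarrow> 'a \<Rightarrow> real) \<Rightarrow> 'a set \<Rightarrow> bool" where
  "orthonormal_basis B E \<longleftrightarrow>
     (\<forall>e\<in>E. \<forall>e'\<in>E. B e e' = (if e = e' then 1 else 0)) \<and> span E = UNIV"

text \<open>The trace of a bilinear map does not depend on the orthonormal basis chosen.\<close>

definition metric_trace ::
  "('a::euclidean_space \<Rightarrow> 'a \<Rightarrow> real) \<Rightarrow> ('a \<Rightarrow> 'a \<Rightarrow> 'b::real_vector) \<Rightarrow> 'b" where
  "metric_trace B S = (\<Sum>e\<in>(SOME E. orthonormal_basis B E). S e e)"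

definition metric_norm :: "'a metric \<Rightarrow> ('a \<Rightarrow> 'a) \<Rightarrow> 'a \<Rightarrow> real" where
  "metric_norm g Z u = sqrt (g u (Z u) (Z u))"


subsection \<open>Immersed hypersurfaces with a transversal field\<close>

definition pushforward :: "('a::euclidean_space \<Rightarrow> 'b::euclidean_space) \<Rightarrow> ('a \<Rightarrow> 'a) \<Rightarrow> 'a \<Rightarrow> 'b" where
  "pushforward f Z u = frechet_derivative f (at u) (Z u)"

definition immersion :: "('a::euclidean_space \<Rightarrow> 'b::euclidean_space) \<Rightarrow> bool" where
  "immersion f \<longleftrightarrow> smooth_map f \<and> (\<forall>u. inj (frechet_derivative f (at u)))"

definition transversal_hypersurface ::
  "('a::euclidean_space \<Rightarrow> 'b::euclidean_space) \<Rightarrow> ('a \<Rightarrow> 'b) \<Rightarrow> bool" where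
  "transversal_hypersurface f \<xi> \<longleftrightarrow>
     DIM('b) = DIM('a) + 1 \<and> immersion f \<and> (\<forall>u. \<xi> u \<notin> range (frechet_derivative f (at u)))"

text \<open>The two components of the Gauss formula
  \<open>D\<^sub>v(f\<^sub>* Z) = f\<^sub>*(\<nabla>\<^sub>v Z) + G(v, Z) \<xi>\<close>.\<close>

definition gauss_connection ::
  "('a::euclidean_space \<Rightarrow> 'b::euclidean_space) \<Rightarrow> ('a \<Rightarrow> 'b) \<Rightarrow> 'a connection" where
  "gauss_connection f \<xi> Z u v =
     (THE W. \<exists>c. dir_deriv v (pushforward f Z) u = frechet_derivative f (at u) W + c *\<^sub>R \<xi> u)"

definition gauss_form ::
  "('a::euclidean_space \<Rightarrow> 'b::euclidean_space) \<Rightarrow> ('a \<Rightarrow> 'b) \<Rightarrow> 'a metric" where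
  "gauss_form f \<xi> u v w =
     (THE c. \<exists>W. dir_deriv v (pushforward f (\<lambda>_. w)) u = frechet_derivative f (at u) W + c *\<^sub>R \<xi> u)"

definition difference_tensor ::
  "'a connection \<Rightarrow> 'a connection \<Rightarrow> 'a \<Rightarrow> 'a \<Rightarrow> 'a \<Rightarrow> 'a::euclidean_space" where
  "difference_tensor C C' u v w = C (\<lambda>_. w) u v - C' (\<lambda>_. w) u v"

definition tchebychev :: "'a connection \<Rightarrow> 'a metric \<Rightarrow> 'a \<Rightarrow> 'a::euclidean_space" where
  "tchebychev C g u =
     (1 / real DIM('a)) *\<^sub>R metric_trace (g u) (difference_tensor C (levi_civita g) u)"

definition euclidean_complete :: "('a::euclidean_space \<Rightarrow> 'b::euclidean_space) \<Rightarrow> bool" where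
  "euclidean_complete f \<longleftrightarrow>
     (\<forall>B. inner_product_form B \<longrightarrow>
        complete_metric (\<lambda>u v w. B (frechet_derivative f (at u) v) (frechet_derivative f (at u) w)))"


subsection \<open>Calabi geometry of surfaces\<close>

definition calabi_field :: "'a \<Rightarrow> real^3" where
  "calabi_field u = vector [0, 0, 1]"

definition calabi_metric :: "(real^2 \<Rightarrow> real^3) \<Rightarrow> (real^2) metric" where
  "calabi_metric x = gauss_form x calabi_field"

definition calabi_connection :: "(real^2 \<Rightarrow> real^3) \<Rightarrow> (real^2) connection" where
  "calabi_connection x = gauss_connection x calabi_field"

definition calabi_surface :: "(real^2 \<Rightarrow> real^3) \<Rightarrow> bool" where
  "calabi_surface x \<longleftrightarrow>
     transversal_hypersurface x calabi_field \<and> (\<forall>u. inner_product_form (calabi_metric x u))"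

definition calabi_tchebychev :: "(real^2 \<Rightarrow> real^3) \<Rightarrow> real^2 \<Rightarrow> real^2" where
  "calabi_tchebychev x = tchebychev (calabi_connection x) (calabi_metric x)"

definition hessian :: "(real^'n \<Rightarrow> real) \<Rightarrow> real^'n \<Rightarrow> real^'n^'n" where
  "hessian f X = (\<chi> i j. dir_deriv (axis i 1) (dir_deriv (axis j 1) f) X)"

text \<open>\<open>U\<close> ranges over the parts of the surface lying on the graph of some function \<open>f\<close>.  As the
  surface is an immersion transversal to the third axis, such neighbourhoods exist around
  every point, and the derivatives of \<open>f\<close> on the open projection of \<open>U\<close> are determined
  by the surface.\<close>

definition calabi_affine_maximal :: "(real^2 \<Rightarrow> real^3) \<Rightarrow> bool" where
  "calabi_affine_maximal x \<longleftrightarrow> calabi_surface x \<and>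
     (\<forall>U (f :: real^2 \<Rightarrow> real).
        open U \<and> (\<forall>u\<in>U. x u $ 3 = f (vector [x u $ 1, x u $ 2])) \<longrightarrow>
        (\<forall>u\<in>U. laplacian (calabi_metric x)
           (\<lambda>p. ln (det (hessian f (vector [x p $ 1, x p $ 2])))) u = 0))"


subsection \<open>Centroaffine geometry\<close>

text \<open>The Gauss formula \<open>D\<^sub>v(y\<^sub>* Z) = y\<^sub>*(\<nabla>\<^sub>v Z) - \<epsilon> h(v, Z) y\<close> is the one for the transversal field
  \<open>-\<epsilon> y\<close>.\<close>

definition centroaffine_metric ::
  "real \<Rightarrow> ('a::euclidean_space \<Rightarrow> 'b::euclidean_space) \<Rightarrow> 'a metric" where
  "centroaffine_metric \<epsilon> y = gauss_form y (\<lambda>u. (- \<epsilon>) *\<^sub>R y u)"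

definition centroaffine_connection ::
  "real \<Rightarrow> ('a::euclidean_space \<Rightarrow> 'b::euclidean_space) \<Rightarrow> 'a connection" where
  "centroaffine_connection \<epsilon> y = gauss_connection y (\<lambda>u. (- \<epsilon>) *\<^sub>R y u)"

text \<open>Elliptic type is \<open>\<epsilon> = 1\<close>, hyperbolic type is \<open>\<epsilon> = -1\<close>.\<close>

definition centroaffine_hypersurface ::
  "real \<Rightarrow> ('a::euclidean_space \<Rightarrow> 'b::euclidean_space) \<Rightarrow> bool" where
  "centroaffine_hypersurface \<epsilon> y \<longleftrightarrow> \<epsilon> \<in> {1, -1} \<and> transversal_hypersurface y y \<and>
     (\<forall>u. inner_product_form (centroaffine_metric \<epsilon> y u))"

abbreviation elliptic_centroaffine_hypersurface ::
  "('a::euclidean_space \<Rightarrow> 'b::euclidean_space) \<Rightarrow> bool" where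
  "elliptic_centroaffine_hypersurface \<equiv> centroaffine_hypersurface 1"

definition centroaffine_tchebychev ::
  "real \<Rightarrow> ('a::euclidean_space \<Rightarrow> 'b::euclidean_space) \<Rightarrow> 'a \<Rightarrow> 'a" where
  "centroaffine_tchebychev \<epsilon> y = tchebychev (centroaffine_connection \<epsilon> y) (centroaffine_metric \<epsilon> y)"

definition centroaffine_extremal ::
  "real \<Rightarrow> ('a::euclidean_space \<Rightarrow> 'b::euclidean_space) \<Rightarrow> bool" where
  "centroaffine_extremal \<epsilon> y \<longleftrightarrow> centroaffine_hypersurface \<epsilon> y \<and>
     (\<forall>u. divergence (centroaffine_metric \<epsilon> y) (centroaffine_tchebychev \<epsilon> y) u = 0)"

lemma vector_4:
  "(vector [a, b, c, d] :: 'a::zero^4) $ 1 = a"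
  "(vector [a, b, c, d] :: 'a::zero^4) $ 2 = b"
  "(vector [a, b, c, d] :: 'a::zero^4) $ 3 = c"
  "(vector [a, b, c, d] :: 'a::zero^4) $ 4 = d"
  unfolding vector_def by simp_all

end

theory Submission
  imports Defs
begin

text \<open>
  In the parameters the Gauss formula of \<open>x\<close> has no mixed term, and the third components of the
  second derivatives are arranged so that the Calabi metric is \<open>du\<^sub>1\<^sup>2 + du\<^sub>2\<^sup>2\<close>.  In the same way the
  centroaffine metric of \<open>y\<close> is \<open>dt\<^sup>2 + du\<^sub>1\<^sup>2 + du\<^sub>2\<^sup>2\<close>, so the Tchebychev fields are traces of the
  induced connections: \<open>(u\<^sub>1, - u\<^sub>2)\<close> and \<open>(4, 2 u\<^sub>1, - 2 u\<^sub>2) / 3\<close>, both divergence free.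
  Euclidean completeness holds because \<open>x\<close> is proper, although its second component is bounded:
  the third component dominates \<open>ln (1 + u\<^sub>2\<^sup>2) / 4\<close>.
\<close>

section \<open>Directional derivatives and coordinates\<close>

lemma dir_deriv_eq: "(F has_derivative F') (at u) \<Longrightarrow> dir_deriv v F u = F' v"
  unfolding dir_deriv_def using frechet_derivative_at by metis

lemma dir_deriv_const [simp]: "dir_deriv v (\<lambda>_. c) u = 0"
  by (rule dir_deriv_eq[of _ "\<lambda>_. 0", simplified]) simp

lemma pushforward_const: "pushforward f (\<lambda>_. w) = dir_deriv w f"
  by (simp add: pushforward_def dir_deriv_def fun_eq_iff)

lemma has_derivative_vec:
  fixes F :: "'a::real_normed_vector \<Rightarrow> real^'n"
  assumes "\<And>i. ((\<lambda>u. F u $ i) has_derivative (\<lambda>v. D v $ i)) (at u)"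
  shows "(F has_derivative D) (at u)"
  unfolding has_derivative_componentwise_within[of F]
  using assms by (auto simp: Basis_vec_def inner_axis)

subsection \<open>Smooth maps\<close>

text \<open>Closure under antiderivatives makes the class stable under \<^const>\<open>dir_deriv\<close> and lets it contain
  the error-function-like integrals.\<close>

inductive smooth_term :: "('a::euclidean_space \<Rightarrow> real) \<Rightarrow> bool" where
  const: "smooth_term (\<lambda>_. c)"
| linear: "bounded_linear L \<Longrightarrow> smooth_term L"
| add: "smooth_term f \<Longrightarrow> smooth_term g \<Longrightarrow> smooth_term (\<lambda>u. f u + g u)"
| mult: "smooth_term f \<Longrightarrow> smooth_term g \<Longrightarrow> smooth_term (\<lambda>u. f u * g u)"
| exp: "smooth_term f \<Longrightarrow> smooth_term (\<lambda>u. exp (f u))"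
| antideriv: "(\<And>s. (\<phi> has_real_derivative \<psi> s) (at s)) \<Longrightarrow> smooth_term f \<Longrightarrow>
    smooth_term (\<lambda>u. \<psi> (f u)) \<Longrightarrow> smooth_term (\<lambda>u. \<phi> (f u))"

text \<open>Each rule differentiates within the class: sums and products in the usual way,
  \<open>exp\<close> by reproducing itself, antiderivatives by the chain rule, where the premise on
  \<open>\<lambda>u. \<psi> (f u)\<close> supplies the outer factor. The direction \<open>v\<close>
  stays fixed, so the derivative is again a real function of the point.\<close>

lemma smooth_term_has_derivative:
  "smooth_term f \<Longrightarrow>
    \<exists>f'. (\<forall>u. (f has_derivative f' u) (at u)) \<and> (\<forall>v. smooth_term (\<lambda>u. f' u v))"
proof (induction rule: smooth_term.induct)
  case (const c)
  show ?case by (rule exI[of _ "\<lambda>_ _. 0"]) (auto intro: smooth_term.const)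
next
  case (linear L)
  then show ?case
    by (intro exI[of _ "\<lambda>_. L"]) (auto intro: smooth_term.const bounded_linear_imp_has_derivative)
next
  case (add f g)
  then obtain f' g' where *: "\<And>u. (f has_derivative f' u) (at u)" "\<And>v. smooth_term (\<lambda>u. f' u v)"
    "\<And>u. (g has_derivative g' u) (at u)" "\<And>v. smooth_term (\<lambda>u. g' u v)" by blast
  show ?case
    by (rule exI[of _ "\<lambda>u v. f' u v + g' u v"])
      (auto intro!: smooth_term.intros(3) derivative_eq_intros *)
next
  case (mult f g)
  then obtain f' g' where *: "\<And>u. (f has_derivative f' u) (at u)" "\<And>v. smooth_term (\<lambda>u. f' u v)"
    "\<And>u. (g has_derivative g' u) (at u)" "\<And>v. smooth_term (\<lambda>u. g' u v)" by blast
  show ?case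
    by (rule exI[of _ "\<lambda>u v. f u * g' u v + f' u v * g u"])
      (auto intro!: smooth_term.intros(3,4) has_derivative_mult * mult.hyps)
next
  case (exp f)
  then obtain f' where *: "\<And>u. (f has_derivative f' u) (at u)" "\<And>v. smooth_term (\<lambda>u. f' u v)"
    by blast
  show ?case
    by (rule exI[of _ "\<lambda>u v. exp (f u) * f' u v"])
      (auto intro!: smooth_term.intros(4,5) derivative_eq_intros * exp.hyps)
next
  case (antideriv \<phi> \<psi> f)
  then obtain f' where *: "\<And>u. (f has_derivative f' u) (at u)" "\<And>v. smooth_term (\<lambda>u. f' u v)"
    by blast
  have "((\<lambda>u. \<phi> (f u)) has_derivative (\<lambda>v. \<psi> (f u) * f' u v)) (at u)" for u
    using has_derivative_compose[OF *(1) antideriv.hyps(1)[unfolded has_field_derivative_def]] .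
  then show ?case
    by (intro exI[of _ "\<lambda>u v. \<psi> (f u) * f' u v"])
      (auto intro!: smooth_term.intros(4) * antideriv.hyps)
qed

lemma smooth_term_neg: "smooth_term f \<Longrightarrow> smooth_term (\<lambda>u. - f u)"
  using smooth_term.mult[OF smooth_term.const[of "-1"]] by fastforce

lemma smooth_term_power2: "smooth_term f \<Longrightarrow> smooth_term (\<lambda>u. (f u)\<^sup>2)"
  unfolding power2_eq_square by (intro smooth_term.mult)

lemma smooth_map_componentwise:
  fixes F :: "'a::euclidean_space \<Rightarrow> real^'n"
  assumes "\<And>i. smooth_term (\<lambda>u. F u $ i)"
  shows "smooth_map F"
proof -
  \<comment> \<open>The map is arbitrary here because the induction over the list of directions
    applies this to the iterated derivatives of the given one.\<close>
  have step: "F differentiable (at u) \<and> (\<forall>i. smooth_term (\<lambda>u. dir_deriv v F u $ i))"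
    if "\<forall>i. smooth_term (\<lambda>u. F u $ i)" for F :: "'a \<Rightarrow> real^'n" and u v
  proof -
    have "\<forall>i. \<exists>f'. (\<forall>u. ((\<lambda>u. F u $ i) has_derivative f' u) (at u)) \<and>
        (\<forall>v. smooth_term (\<lambda>u. f' u v))"
      using that by (blast intro: smooth_term_has_derivative)
    then obtain f' where f': "\<And>i u. ((\<lambda>u. F u $ i) has_derivative f' i u) (at u)"
      "\<And>i v. smooth_term (\<lambda>u. f' i u v)"
      unfolding choice_iff by blast
    have D: "(F has_derivative (\<lambda>v. \<chi> i. f' i u v)) (at u)" for u
      by (rule has_derivative_vec) (simp add: f')
    have "dir_deriv v F = (\<lambda>u. \<chi> i. f' i u v)"
      by (rule ext) (rule dir_deriv_eq[OF D])
    then show ?thesis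
      using f'(2) D by (auto simp: differentiable_def)
  qed
  have "\<forall>i. smooth_term (\<lambda>u. foldr dir_deriv vs F u $ i)" for vs
    by (induction vs) (use assms step in auto)
  then show ?thesis
    unfolding smooth_map_def using step by blast
qed

subsection \<open>Length distance and completeness\<close>

text \<open>The first bound integrates the velocity of the image curve under \<open>F\<close>, which
  the speed dominates; the second compares with the straight chart segment. The first bound also
  makes the set of lengths bounded below, and the segment makes it nonempty, so the infimum is
  meaningful.\<close>

lemma riemannian_distance_bounds:
  fixes g :: "'a::euclidean_space metric" and F :: "'a \<Rightarrow> 'b::euclidean_space"
  assumes F: "\<And>u. (F has_derivative F' u) (at u)"
    and lower: "\<And>u v. norm (F' u v) \<le> sqrt (g u v v)"
    and cont: "\<And>v. continuous_on UNIV (\<lambda>u. g u v v)"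
  shows "norm (F q - F p) \<le> riemannian_distance g p q" (is ?lower)
    and "(\<And>u. u \<in> closed_segment p q \<Longrightarrow> sqrt (g u (q - p) (q - p)) \<le> c) \<Longrightarrow>
      riemannian_distance g p q \<le> c" (is "PROP ?upper")
proof -
  let ?S = "{integral {0..1} (speed g \<gamma>) |\<gamma>.
     valid_path \<gamma> \<and> speed g \<gamma> integrable_on {0..1} \<and> pathstart \<gamma> = p \<and> pathfinish \<gamma> = q}"
  have speed_line: "speed g (linepath p q) = (\<lambda>t. sqrt (g (linepath p q t) (q - p) (q - p)))"
    by (rule ext) (simp add: speed_def Let_def)
  have int: "speed g (linepath p q) integrable_on {0..1}"
    unfolding speed_line
    by (intro integrable_continuous_real continuous_intros continuous_on_compose2[OF cont]) auto
  have mem: "integral {0..1} (speed g (linepath p q)) \<in> ?S"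
    using int by auto
  have bound: "norm (F q - F p) \<le> l" if "l \<in> ?S" for l
  proof -
    from that obtain \<gamma> where \<gamma>: "l = integral {0..1} (speed g \<gamma>)" "valid_path \<gamma>"
      "speed g \<gamma> integrable_on {0..1}" "\<gamma> 0 = p" "\<gamma> 1 = q"
      by (auto simp: pathstart_def pathfinish_def)
    then obtain S where S: "finite S" "\<gamma> C1_differentiable_on ({0..1} - S)" "continuous_on {0..1} \<gamma>"
      by (auto simp: valid_path_def piecewise_C1_differentiable_on_def)
    \<comment> \<open>The velocity of the image curve; the strong fundamental theorem tolerates the
      finite set \<open>S\<close> where the path may fail to be differentiable.\<close>
    define h where "h t = F' (\<gamma> t) (vector_derivative \<gamma> (at t))" for t
    have contF: "continuous_on UNIV F"
      using has_derivative_continuous[OF F] by (simp add: continuous_on_eq_continuous_at)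
    have "(h has_integral ((F \<circ> \<gamma>) 1 - (F \<circ> \<gamma>) 0)) {0..1}"
    proof (rule fundamental_theorem_of_calculus_strong[OF S(1)])
      fix t assume "t \<in> {0..1} - S"
      then have "(\<gamma> has_vector_derivative vector_derivative \<gamma> (at t)) (at t)"
        using S(2) by (auto simp: C1_differentiable_on_eq vector_derivative_works)
      from vector_derivative_diff_chain_within[OF this has_derivative_at_withinI[OF F]]
      show "((F \<circ> \<gamma>) has_vector_derivative h t) (at t)" by (simp add: h_def)
    qed (auto simp: o_def intro!: continuous_on_compose2[OF contF S(3)])
    then have hi: "(h has_integral (F q - F p)) {0..1}" using \<gamma> by simp
    have "norm (integral {0..1} h) \<le> integral {0..1} (speed g \<gamma>)"
      by (rule integral_norm_bound_integral)
        (use hi \<gamma> lower in \<open>auto simp: h_def speed_def Let_def has_integral_integrable\<close>)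
    then show ?thesis using hi \<gamma> by (simp add: integral_unique)
  qed
  show ?lower
    unfolding riemannian_distance_def by (rule cInf_greatest) (use mem bound in auto)
  assume c: "\<And>u. u \<in> closed_segment p q \<Longrightarrow> sqrt (g u (q - p) (q - p)) \<le> c"
  have "riemannian_distance g p q \<le> integral {0..1} (speed g (linepath p q))"
    unfolding riemannian_distance_def
    by (rule cInf_lower[OF mem]) (auto intro!: bdd_belowI[of _ "norm (F q - F p)"] bound)
  also have "\<dots> \<le> integral {0..1} (\<lambda>t::real. c)"
    by (rule integral_le[OF int]) (auto simp: speed_line linepath_in_path intro!: c)
  finally show "riemannian_distance g p q \<le> c" by simp
qed

text \<open>\<open>F\<close> transfers Cauchy sequences of the length distance to Cauchy sequences of the chart.  Bounding
  the speed of chart segments then gives convergence without the triangle inequality for the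
  length distance.\<close>

lemma complete_metricI:
  fixes g :: "'a::euclidean_space metric" and F :: "'a \<Rightarrow> 'b::euclidean_space"
  assumes F: "\<And>u. (F has_derivative F' u) (at u)"
    and lower: "\<And>u v. norm (F' u v) \<le> sqrt (g u v v)"
    and cont: "\<And>v. continuous_on UNIV (\<lambda>u. g u v v)"
    and upper: "\<And>u v. sqrt (g u v v) \<le> C u * norm v"
    and C: "continuous_on UNIV C"
    and Cauchy: "\<And>s. Cauchy (\<lambda>n::nat. F (s n)) \<Longrightarrow> Cauchy s"
  shows "complete_metric g"
  unfolding complete_metric_def
proof (intro allI impI)
  note bounds = riemannian_distance_bounds[of F F' g, OF F lower cont]
  fix s :: "nat \<Rightarrow> 'a"
  assume s: "\<forall>e>0. \<exists>N. \<forall>m\<ge>N. \<forall>n\<ge>N. riemannian_distance g (s m) (s n) < e"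
  have "Cauchy (\<lambda>n. F (s n))"
    unfolding Cauchy_def
  proof (intro allI impI)
    fix e :: real assume "e > 0"
    with s obtain N where "\<forall>m\<ge>N. \<forall>n\<ge>N. riemannian_distance g (s m) (s n) < e" by blast
    then show "\<exists>M. \<forall>m\<ge>M. \<forall>n\<ge>M. dist (F (s m)) (F (s n)) < e"
      by (metis bounds(1) dist_norm dist_commute order_le_less_trans)
  qed
  then obtain l where l: "s \<longlonglongrightarrow> l"
    using Cauchy Cauchy_convergent_iff convergent_def by blast
  \<comment> \<open>Continuity bounds \<open>C\<close> by \<open>C l + 1\<close> on a ball about the
    limit. Once \<open>s n\<close> lies in this ball, so does the segment from \<open>s n\<close> to
    \<open>l\<close>, whose length bound then tends to 0.\<close>
  obtain r where r: "r > 0" "\<And>u. dist u l < r \<Longrightarrow> C u < C l + 1"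
  proof -
    have "isCont C l" using C by (simp add: continuous_on_eq_continuous_at)
    then show ?thesis
      using that unfolding continuous_at_eps_delta dist_real_def
      by (smt (verit, best))
  qed
  have "(\<lambda>n. riemannian_distance g (s n) l) \<longlonglongrightarrow> 0"
  proof (rule tendsto_sandwich)
    show "\<forall>\<^sub>F n in sequentially. 0 \<le> riemannian_distance g (s n) l"
      using bounds(1) norm_ge_zero order_trans by (intro always_eventually) blast
    have "\<forall>\<^sub>F n in sequentially. dist (s n) l < r"
      using l r(1) tendstoD by blast
    then show "\<forall>\<^sub>F n in sequentially. riemannian_distance g (s n) l \<le> (C l + 1) * norm (l - s n)"
    proof eventually_elim
      case (elim n)
      show ?case
      proof (rule bounds(2))
        fix u assume "u \<in> closed_segment (s n) l"
        then have "dist u l < r"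
          using elim dist_in_closed_segment by (metis dist_commute order_le_less_trans)
        then show "sqrt (g u (l - s n) (l - s n)) \<le> (C l + 1) * norm (l - s n)"
          using order_trans[OF upper mult_right_mono] r(2) by (metis less_imp_le norm_ge_zero)
      qed
    qed
    have "(\<lambda>n. (C l + 1) * norm (l - s n)) \<longlonglongrightarrow> (C l + 1) * norm (l - l)"
      by (intro tendsto_intros l)
    then show "(\<lambda>n. (C l + 1) * norm (l - s n)) \<longlonglongrightarrow> 0" by simp
  qed simp
  then show "\<exists>l. (\<lambda>n. riemannian_distance g (s n) l) \<longlonglongrightarrow> 0" ..
qed

text \<open>Compactness of the unit sphere gives positive extreme values of
  \<open>sqrt (B v v)\<close>, and homogeneity carries them to all vectors.\<close>

lemma inner_product_form_bounds:
  fixes B :: "'a::euclidean_space \<Rightarrow> 'a \<Rightarrow> real"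
  assumes "inner_product_form B"
  obtains c K where "c > 0" "K > 0" "\<And>v. c * norm v \<le> sqrt (B v v)" "\<And>v. sqrt (B v v) \<le> K * norm v"
proof -
  have bil: "bounded_bilinear B" and pos: "\<And>v. v \<noteq> 0 \<Longrightarrow> B v v > 0"
    using assms by (auto simp: inner_product_form_def bilinear_conv_bounded_bilinear)
  interpret bounded_bilinear B by (rule bil)
  let ?S = "sphere (0::'a) 1"
  have ne: "?S \<noteq> {}" by simp
  have cont: "continuous_on ?S (\<lambda>v. sqrt (B v v))"
    by (intro continuous_intros continuous_on)
  obtain a where a: "a \<in> ?S" "\<And>v. v \<in> ?S \<Longrightarrow> sqrt (B a a) \<le> sqrt (B v v)"
    using continuous_attains_inf[OF compact_sphere ne cont] by auto
  obtain b where b: "b \<in> ?S" "\<And>v. v \<in> ?S \<Longrightarrow> sqrt (B v v) \<le> sqrt (B b b)"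
    using continuous_attains_sup[OF compact_sphere ne cont] by auto
  have hom: "sqrt (B v v) = norm v * sqrt (B (v /\<^sub>R norm v) (v /\<^sub>R norm v))" if "v \<noteq> 0" for v
    using that by (simp add: scaleR_left scaleR_right real_sqrt_mult real_sqrt_divide)
  have unit: "v /\<^sub>R norm v \<in> ?S" if "v \<noteq> 0" for v
    using that by simp
  show thesis
  proof (rule that)
    show "sqrt (B a a) > 0" "sqrt (B b b) > 0"
      using a(1) b(1) pos[of a] pos[of b] by (cases "a = 0"; cases "b = 0"; simp)+
    show "sqrt (B a a) * norm v \<le> sqrt (B v v)" for v
    proof (cases "v = 0")
      case False
      show ?thesis
        unfolding hom[OF False] using a(2)[OF unit[OF False]]
        by (simp add: mult.commute mult_left_mono)
    qed (simp add: zero_left)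
    show "sqrt (B v v) \<le> sqrt (B b b) * norm v" for v
    proof (cases "v = 0")
      case False
      show ?thesis
        unfolding hom[OF False] using b(2)[OF unit[OF False]]
        by (simp add: mult.commute mult_left_mono)
    qed (simp add: zero_left)
  qed
qed

subsection \<open>The flat metric of the chart\<close>

lemma inner_product_form_inner: "inner_product_form (inner :: 'a::euclidean_space \<Rightarrow> _)"
  by (auto simp: inner_product_form_def bilinear_conv_bounded_bilinear bounded_bilinear_inner
      inner_commute)

lemma christoffel_inner [simp]: "christoffel (\<lambda>_. inner) u v w = 0"
proof -
  have "christoffel (\<lambda>_. inner) u = (\<lambda>_ _. 0 :: 'a)"
    unfolding christoffel_def
  proof (rule the_equality)
    show "bilinear (\<lambda>_ _. 0 :: 'a) \<and> (\<forall>v w. (0::'a) = 0) \<and>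
      (\<forall>v w z. dir_deriv v (\<lambda>p. w \<bullet> z) u = 0 \<bullet> z + w \<bullet> 0)"
      by (simp add: bilinear_def linear_iff)
    fix \<Gamma> :: "'a \<Rightarrow> 'a \<Rightarrow> 'a"
    assume "bilinear \<Gamma> \<and> (\<forall>v w. \<Gamma> v w = \<Gamma> w v) \<and>
      (\<forall>v w z. dir_deriv v (\<lambda>p. w \<bullet> z) u = \<Gamma> v w \<bullet> z + w \<bullet> \<Gamma> v z)"
    then have sym: "\<Gamma> v w = \<Gamma> w v" and skew: "\<Gamma> v w \<bullet> z = - (\<Gamma> v z \<bullet> w)" for v w z
      by (auto simp: inner_commute eq_neg_iff_add_eq_0)
    \<comment> \<open>a trilinear form symmetric in one pair of arguments and skew in another vanishes\<close>
    have "\<Gamma> v w \<bullet> z = 0" for v w z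
      using skew[of v w z] skew[of z v w] skew[of w z v]
      by (simp add: sym[of z v] sym[of w z] sym[of w v])
    then show "\<Gamma> = (\<lambda>_ _. 0)"
      by (metis (no_types) ext inner_eq_zero_iff)
  qed
  then show ?thesis by simp
qed

lemma levi_civita_inner [simp]: "levi_civita (\<lambda>_. inner) Z u v = dir_deriv v Z u"
  by (simp add: levi_civita_def)

lemma flat_metric_inner: "flat_metric (\<lambda>_. inner)"
  by (simp add: flat_metric_def curvature_def)

lemma complete_metric_inner: "complete_metric (\<lambda>_::'a::euclidean_space. inner)"
  by (rule complete_metricI[where F = "\<lambda>u. u" and F' = "\<lambda>_ v. v" and C = "\<lambda>_. 1"])
    (auto simp: norm_eq_sqrt_inner)

lemma divergence_inner:
  assumes "(Z has_derivative Z') (at u)"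
  shows "divergence (\<lambda>_. inner) Z u = linear_trace Z'"
  by (simp add: divergence_def linear_trace_def dir_deriv_eq[OF assms])

lemma gradient_inner:
  assumes "(\<phi> has_derivative (\<lambda>v. w \<bullet> v)) (at u)"
  shows "gradient (\<lambda>_. inner) \<phi> u = w"
  unfolding gradient_def dir_deriv_eq[OF assms]
  by (rule the_equality) (auto simp: vector_eq_rdot)

text \<open>The divergence differentiates the gradient field, so the gradient has to be known on a
  neighbourhood of \<open>u\<close>. A local hypothesis suits functions that are controlled only on
  part of the surface.\<close>

lemma laplacian_inner:
  assumes "open U" "u \<in> U"
    and "\<And>p. p \<in> U \<Longrightarrow> (\<phi> has_derivative (\<lambda>v. grad p \<bullet> v)) (at p)"
    and "(grad has_derivative H) (at u)"
  shows "laplacian (\<lambda>_. inner) \<phi> u = linear_trace H"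
  unfolding laplacian_def
  by (intro divergence_inner has_derivative_transform_within_open[OF assms(4,1,2)])
    (simp add: gradient_inner[OF assms(3)])

text \<open>The trace is taken over an unspecified orthonormal basis \<open>E\<close>. Expanding
  each second argument in the standard basis, exchanging the sums and recombining the first
  arguments by the \<open>E\<close>-expansion of \<open>b\<close> gives the standard trace.\<close>

lemma metric_trace_inner:
  fixes S :: "'a::euclidean_space \<Rightarrow> 'a \<Rightarrow> 'b::real_vector"
  assumes "bilinear S"
  shows "metric_trace inner S = (\<Sum>b\<in>Basis. S b b)"
proof -
  define E where "E = (SOME E. orthonormal_basis (inner :: 'a \<Rightarrow> _) E)"
  have "orthonormal_basis (inner :: 'a \<Rightarrow> _) Basis"
    by (auto simp: orthonormal_basis_def inner_Basis)
  then have E: "orthonormal_basis inner E"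
    unfolding E_def by (rule someI)
  have orth: "pairwise orthogonal E" and norm: "\<And>e. e \<in> E \<Longrightarrow> norm e = 1"
    using E by (auto simp: orthonormal_basis_def pairwise_def orthogonal_def norm_eq_sqrt_inner)
  have fin: "finite E" using orth by (rule pairwise_orthogonal_imp_finite)
  have expand: "(\<Sum>e\<in>E. (v \<bullet> e) *\<^sub>R e) = v" for v
    using E by (intro orthonormal_basis_expand orth norm fin) (auto simp: orthonormal_basis_def)
  have lin: "linear (\<lambda>v. S v w)" "linear (S v)" for v w
    using assms by (auto simp: bilinear_def)
  have "(\<Sum>e\<in>E. S e e) = (\<Sum>e\<in>E. S e (\<Sum>b\<in>Basis. (e \<bullet> b) *\<^sub>R b))"
    by (simp add: euclidean_representation)
  also have "\<dots> = (\<Sum>e\<in>E. \<Sum>b\<in>Basis. (e \<bullet> b) *\<^sub>R S e b)"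
    by (simp add: linear_sum[OF lin(2)] linear_cmul[OF lin(2)])
  also have "\<dots> = (\<Sum>b\<in>Basis. \<Sum>e\<in>E. (e \<bullet> b) *\<^sub>R S e b)"
    by (rule sum.swap)
  also have "\<dots> = (\<Sum>b\<in>Basis. S (\<Sum>e\<in>E. (b \<bullet> e) *\<^sub>R e) b)"
    by (simp add: linear_sum[OF lin(1)] linear_cmul[OF lin(1)] inner_commute)
  also have "\<dots> = (\<Sum>b\<in>Basis. S b b)"
    by (simp add: expand)
  finally show ?thesis by (simp add: metric_trace_def E_def)
qed

text \<open>The flat Levi-Civita connection annihilates constant fields, so the difference tensor is
  the given connection itself.\<close>

lemma tchebychev_inner:
  fixes S :: "'a::euclidean_space \<Rightarrow> 'a \<Rightarrow> 'a"
  assumes "bilinear S" "\<And>v w. C (\<lambda>_. w) u v = S v w"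
  shows "tchebychev C (\<lambda>_. inner) u = (1 / real DIM('a)) *\<^sub>R (\<Sum>b\<in>Basis. S b b)"
proof -
  have "difference_tensor C (levi_civita (\<lambda>_. inner)) u = S"
    by (auto simp: difference_tensor_def fun_eq_iff assms(2))
  then show ?thesis
    by (simp add: tchebychev_def metric_trace_inner[OF assms(1)])
qed

subsection \<open>The Gauss formula\<close>

text \<open>Any exhibited decomposition is the one picked out by the definite descriptions, since
  the tangent space and \<open>\<xi> u\<close> are independent: unequal transversal coefficients
  would, after division by their difference, put \<open>\<xi> u\<close> into the tangent space, and
  injectivity then fixes the tangential part.\<close>

lemma gauss_formula:
  assumes "linear (frechet_derivative f (at u))"
    and "inj (frechet_derivative f (at u))" "\<xi> u \<notin> range (frechet_derivative f (at u))"
    and eq: "dir_deriv v (dir_deriv w f) u = frechet_derivative f (at u) W + c *\<^sub>R \<xi> u"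
  shows "gauss_connection f \<xi> (\<lambda>_. w) u v = W" "gauss_form f \<xi> u v w = c"
proof -
  let ?D = "frechet_derivative f (at u)"
  have uniq: "c' = c \<and> W' = W" if "?D W + c *\<^sub>R \<xi> u = ?D W' + c' *\<^sub>R \<xi> u" for c' W'
  proof -
    have *: "(c' - c) *\<^sub>R \<xi> u = ?D (W - W')"
      using that by (simp add: linear_diff[OF assms(1)] algebra_simps)
    have "c' = c"
    proof (rule ccontr)
      assume "c' \<noteq> c"
      then have "\<xi> u = ?D ((W - W') /\<^sub>R (c' - c))"
        by (simp add: linear_cmul[OF assms(1)] flip: *)
      with assms(3) show False by blast
    qed
    with that assms(2) show ?thesis by (auto dest: injD)
  qed
  show "gauss_connection f \<xi> (\<lambda>_. w) u v = W"
    unfolding gauss_connection_def pushforward_const eq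
    by (rule the_equality) (use uniq in blast)+
  show "gauss_form f \<xi> u v w = c"
    unfolding gauss_form_def pushforward_const eq
    by (rule the_equality) (use uniq in blast)+
qed

subsection \<open>The integrals defining the surface\<close>

lemma interval_integral_has_real_derivative:
  assumes "continuous_on UNIV f"
  shows "((\<lambda>s. LBINT t=0..ereal s. f t) has_real_derivative f s) (at s)"
proof -
  \<comment> \<open>This interval has both 0 and \<open>s\<close> in its interior, so the derivative
    within it is the full derivative at \<open>s\<close>.\<close>
  let ?a = "- \<bar>s\<bar> - 1" and ?b = "\<bar>s\<bar> + 1"
  have "((\<lambda>s. LBINT t=ereal 0..ereal s. f t) has_vector_derivative f s) (at s within {?a..?b})"
    by (rule interval_integral_FTC2) (auto intro: continuous_on_subset[OF assms])
  moreover have "at s within {?a..?b} = at s"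
    by (rule at_within_interior) (auto simp: abs_real_def)
  ultimately show ?thesis
    by (simp add: has_real_derivative_iff_has_vector_derivative zero_ereal_def)
qed

text \<open>Up to the factor sqrt(pi)/2 this is the imaginary error function, and
  \<open>gauss_int\<close> is the error function.\<close>

definition exp_int :: "real \<Rightarrow> real" where
  "exp_int s = (LBINT t=0..s. exp (t\<^sup>2))"

definition gauss_int :: "real \<Rightarrow> real" where
  "gauss_int s = (LBINT t=0..s. exp (- (t\<^sup>2)))"

definition exp_gauss_int :: "real \<Rightarrow> real" where
  "exp_gauss_int s = (LBINT t=0..s. exp (t\<^sup>2) * gauss_int t)"

definition gauss_exp_int :: "real \<Rightarrow> real" where
  "gauss_exp_int s = (LBINT t=0..s. exp (- (t\<^sup>2)) * exp_int t)"

lemma DERIV_exp_int: "(exp_int has_real_derivative exp (s\<^sup>2)) (at s)"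
  unfolding exp_int_def[abs_def]
  by (rule interval_integral_has_real_derivative) (intro continuous_intros)

lemma DERIV_gauss_int: "(gauss_int has_real_derivative exp (- (s\<^sup>2))) (at s)"
  unfolding gauss_int_def[abs_def]
  by (rule interval_integral_has_real_derivative) (intro continuous_intros)

lemma continuous_on_exp_int: "continuous_on UNIV exp_int"
  by (auto intro!: continuous_at_imp_continuous_on DERIV_isCont DERIV_exp_int)

lemma continuous_on_gauss_int: "continuous_on UNIV gauss_int"
  by (auto intro!: continuous_at_imp_continuous_on DERIV_isCont DERIV_gauss_int)

lemma DERIV_exp_gauss_int:
  "(exp_gauss_int has_real_derivative exp (s\<^sup>2) * gauss_int s) (at s)"
  unfolding exp_gauss_int_def[abs_def]
  by (rule interval_integral_has_real_derivative) (intro continuous_intros continuous_on_gauss_int)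

lemma DERIV_gauss_exp_int:
  "(gauss_exp_int has_real_derivative exp (- (s\<^sup>2)) * exp_int s) (at s)"
  unfolding gauss_exp_int_def[abs_def]
  by (rule interval_integral_has_real_derivative) (intro continuous_intros continuous_on_exp_int)

lemmas has_derivative_ints [derivative_intros] =
  has_derivative_compose[OF _ DERIV_exp_int[unfolded has_field_derivative_def]]
  has_derivative_compose[OF _ DERIV_gauss_int[unfolded has_field_derivative_def]]
  has_derivative_compose[OF _ DERIV_exp_gauss_int[unfolded has_field_derivative_def]]
  has_derivative_compose[OF _ DERIV_gauss_exp_int[unfolded has_field_derivative_def]]

lemmas continuous_on_ints [continuous_intros] =
  continuous_on_compose2[OF continuous_on_exp_int _ subset_UNIV]
  continuous_on_compose2[OF continuous_on_gauss_int _ subset_UNIV]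

lemma ints_0 [simp]: "exp_int 0 = 0" "gauss_int 0 = 0" "exp_gauss_int 0 = 0" "gauss_exp_int 0 = 0"
  by (simp_all add: exp_int_def gauss_int_def exp_gauss_int_def gauss_exp_int_def
      interval_integral_endpoints_same flip: zero_ereal_def)

lemma smooth_term_exp_int: "smooth_term f \<Longrightarrow> smooth_term (\<lambda>u. exp_int (f u))"
  by (intro smooth_term.antideriv[OF DERIV_exp_int] smooth_term.exp smooth_term_power2)

lemma smooth_term_gauss_int: "smooth_term f \<Longrightarrow> smooth_term (\<lambda>u. gauss_int (f u))"
  by (intro smooth_term.antideriv[OF DERIV_gauss_int] smooth_term.exp smooth_term_power2
      smooth_term_neg)

lemma smooth_term_exp_gauss_int: "smooth_term f \<Longrightarrow> smooth_term (\<lambda>u. exp_gauss_int (f u))"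
  by (intro smooth_term.antideriv[OF DERIV_exp_gauss_int] smooth_term.exp smooth_term.mult
      smooth_term_power2 smooth_term_gauss_int)

lemma smooth_term_gauss_exp_int: "smooth_term f \<Longrightarrow> smooth_term (\<lambda>u. gauss_exp_int (f u))"
  by (intro smooth_term.antideriv[OF DERIV_gauss_exp_int] smooth_term.exp smooth_term.mult
      smooth_term_power2 smooth_term_exp_int smooth_term_neg)

lemma smooth_term_fst: "smooth_term fst"
  and smooth_term_snd_nth: "smooth_term (\<lambda>p. snd p $ i)"
  and smooth_term_nth: "smooth_term (\<lambda>u. u $ i)"
  by (intro smooth_term.linear bounded_linear_intros bounded_linear_compose[OF bounded_linear_vec_nth])+

lemmas smooth_term_intros = smooth_term.const smooth_term.add smooth_term.mult smooth_term.exp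
  smooth_term_exp_int smooth_term_gauss_int smooth_term_exp_gauss_int smooth_term_gauss_exp_int
  smooth_term_fst smooth_term_snd_nth smooth_term_nth

section \<open>Expansion and growth of the integrals\<close>

lemma DERIV_lower_bound_imp_expanding:
  fixes f :: "real \<Rightarrow> real"
  assumes "\<And>z. (f has_real_derivative f' z) (at z)"
    and "\<And>z. \<bar>z\<bar> \<le> R \<Longrightarrow> k \<le> f' z" and "\<bar>s\<bar> \<le> R" "\<bar>t\<bar> \<le> R"
  shows "k * \<bar>s - t\<bar> \<le> \<bar>f s - f t\<bar>"
proof -
  have *: "k * (s - t) \<le> f s - f t" if ts: "t < s" "\<bar>s\<bar> \<le> R" "\<bar>t\<bar> \<le> R" for s t
  proof -
    obtain z where z: "t < z" "z < s" "f s - f t = (s - t) * f' z"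
      using MVT2[OF ts(1), of f f'] assms(1) by blast
    have "k \<le> f' z" using z ts by (intro assms(2)) auto
    then show ?thesis using z ts by (simp add: mult.commute mult_left_mono)
  qed
  show ?thesis
    using *[of t s] *[of s t] assms(3,4) by (cases s t rule: linorder_cases) auto
qed

lemma exp_int_expanding: "\<bar>s - t\<bar> \<le> \<bar>exp_int s - exp_int t\<bar>"
  using DERIV_lower_bound_imp_expanding[OF DERIV_exp_int, of "max \<bar>s\<bar> \<bar>t\<bar>" 1 s t] by simp

text \<open>The derivative decays at infinity, so the constant is its minimum on [-R, R]. Recovering
  a Cauchy sequence from its values under \<open>gauss_int\<close> therefore requires a bound on the
  arguments.\<close>

lemma gauss_int_expanding:
  assumes "\<bar>s\<bar> \<le> R" "\<bar>t\<bar> \<le> R"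
  shows "exp (- (R\<^sup>2)) * \<bar>s - t\<bar> \<le> \<bar>gauss_int s - gauss_int t\<bar>"
  by (rule DERIV_lower_bound_imp_expanding[OF DERIV_gauss_int _ assms]) (use abs_le_square_iff in fastforce)

lemma exp_int_eq_iff: "exp_int s = exp_int t \<longleftrightarrow> s = t"
  using exp_int_expanding[of s t] by auto

lemma gauss_int_eq_iff: "gauss_int s = gauss_int t \<longleftrightarrow> s = t"
  using gauss_int_expanding[of s "max \<bar>s\<bar> \<bar>t\<bar>" t] by (auto simp: mult_le_0_iff)

text \<open>The form \<open>0 \<le> s * f s\<close> expresses that \<open>f\<close> carries the sign
  of its argument, covering both half-lines at once; it is what the next lemma expects of a
  derivative.\<close>

lemma DERIV_nonneg_imp_sign:
  fixes f :: "real \<Rightarrow> real"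
  assumes "\<And>s. (f has_real_derivative f' s) (at s)" "\<And>s. 0 \<le> f' s" "f 0 = 0"
  shows "0 \<le> s * f s"
proof -
  have "f t \<le> f s" if "t \<le> s" for s t
    by (rule DERIV_nonneg_imp_nondecreasing[OF that]) (use assms in blast)
  from this[of 0 s] this[of s 0] show ?thesis
    using assms(3) by (cases "0 \<le> s") (auto simp: zero_le_mult_iff)
qed

text \<open>The function falls before 0 and rises after it, so its value at 0 is its
  minimum.\<close>

lemma DERIV_sign_imp_nonneg:
  fixes f :: "real \<Rightarrow> real"
  assumes "\<And>s. (f has_real_derivative f' s) (at s)" "\<And>s. 0 \<le> s * f' s" "f 0 = 0"
  shows "0 \<le> f s"
proof (cases s "0 :: real" rule: linorder_cases)
  case less
  obtain z where "z < 0" "f 0 - f s = (0 - s) * f' z"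
    using MVT2[OF less, of f f'] assms(1) by blast
  with less assms(2)[of z] assms(3) show ?thesis
    by (auto simp: zero_le_mult_iff mult_le_0_iff)
next
  case greater
  obtain z where "0 < z" "f s - f 0 = (s - 0) * f' z"
    using MVT2[OF greater, of f f'] assms(1) by blast
  with greater assms(2)[of z] assms(3) show ?thesis
    by (auto simp: zero_le_mult_iff)
qed (simp add: assms(3))

lemma exp_gauss_int_nonneg: "0 \<le> exp_gauss_int s"
proof (rule DERIV_sign_imp_nonneg[OF DERIV_exp_gauss_int])
  fix s
  have "0 \<le> exp (s\<^sup>2) * (s * gauss_int s)"
    using DERIV_nonneg_imp_sign[OF DERIV_gauss_int] by simp
  then show "0 \<le> s * (exp (s\<^sup>2) * gauss_int s)" by (simp add: mult.left_commute)
qed simp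

text \<open>For t > 0 the quotient t exp(t^2) / (2 (1 + t^2)) has the same leading growth as
  \<open>exp_int t\<close> and stays below it, since the difference has a nonnegative derivative and
  vanishes at 0. Multiplied by exp(-t^2) it becomes t / (2 (1 + t^2)), the derivative of ln(1 + t^2)
  / 4, so the integrand of \<open>gauss_exp_int\<close> dominates that derivative.\<close>

lemma gauss_exp_int_ge_ln: "ln (1 + s\<^sup>2) / 4 \<le> gauss_exp_int s"
proof -
  have pos: "0 < 1 + t\<^sup>2" for t :: real by (simp add: add_pos_nonneg)
  have sign: "0 \<le> t * (exp_int t - t * exp (t\<^sup>2) / (2 * (1 + t\<^sup>2)))" for t
  proof (rule DERIV_nonneg_imp_sign[where f = "\<lambda>t. exp_int t - t * exp (t\<^sup>2) / (2 * (1 + t\<^sup>2))"])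
    fix t :: real
    show "((\<lambda>t. exp_int t - t * exp (t\<^sup>2) / (2 * (1 + t\<^sup>2))) has_real_derivative
        exp (t\<^sup>2) * (1 + 3 * t\<^sup>2) / (2 * (1 + t\<^sup>2)\<^sup>2)) (at t)"
    proof -
      have ne: "1 + t\<^sup>2 \<noteq> 0" by (smt (verit) zero_le_power2)
      have "exp (t\<^sup>2) * (1 + 3 * t\<^sup>2) / (2 * (1 + t\<^sup>2)\<^sup>2) = exp (t\<^sup>2) -
         ((exp (t\<^sup>2) + t * (exp (t\<^sup>2) * (2 * t))) * (2 * (1 + t\<^sup>2)) -
          t * exp (t\<^sup>2) * (4 * t)) / (2 * (1 + t\<^sup>2) * (2 * (1 + t\<^sup>2)))"
        using ne by (simp add: divide_simps) algebra
      also have "((\<lambda>t. exp_int t - t * exp (t\<^sup>2) / (2 * (1 + t\<^sup>2))) has_real_derivative \<dots>) (at t)"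
        using ne by (auto intro!: derivative_eq_intros DERIV_exp_int)
      finally show ?thesis .
    qed
    show "0 \<le> exp (t\<^sup>2) * (1 + 3 * t\<^sup>2) / (2 * (1 + t\<^sup>2)\<^sup>2)"
      by simp
  qed simp
  have "0 \<le> gauss_exp_int s - ln (1 + s\<^sup>2) / 4"
  proof (rule DERIV_sign_imp_nonneg[where f = "\<lambda>t. gauss_exp_int t - ln (1 + t\<^sup>2) / 4"])
    fix t :: real
    have "((\<lambda>t. ln (1 + t\<^sup>2)) has_real_derivative 2 * t / (1 + t\<^sup>2)) (at t)"
      using pos[of t] by (auto intro!: derivative_eq_intros)
    from DERIV_diff[OF DERIV_gauss_exp_int DERIV_cdivide[OF this, of 4]]
    have "((\<lambda>t. gauss_exp_int t - ln (1 + t\<^sup>2) / 4) has_real_derivative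
        exp (- (t\<^sup>2)) * exp_int t - 2 * t / (1 + t\<^sup>2) / 4) (at t)" .
    also have "2 * t / (1 + t\<^sup>2) / 4 = t / (2 * (1 + t\<^sup>2))"
      using pos[of t] by (simp add: divide_simps)
    finally show "((\<lambda>t. gauss_exp_int t - ln (1 + t\<^sup>2) / 4) has_real_derivative
        exp (- (t\<^sup>2)) * exp_int t - t / (2 * (1 + t\<^sup>2))) (at t)"
      .
    have "t * (exp (- (t\<^sup>2)) * exp_int t - t / (2 * (1 + t\<^sup>2))) =
        exp (- (t\<^sup>2)) * (t * (exp_int t - t * exp (t\<^sup>2) / (2 * (1 + t\<^sup>2))))"
      by (simp add: algebra_simps exp_minus)
    also have "0 \<le> \<dots>"
      by (rule mult_nonneg_nonneg[OF _ sign]) simp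
    finally show "0 \<le> t * (exp (- (t\<^sup>2)) * exp_int t - t / (2 * (1 + t\<^sup>2)))" .
  qed simp
  then show ?thesis by simp
qed

subsection \<open>The Calabi surface\<close>

definition surf :: "real^2 \<Rightarrow> real^3" where
  "surf u = vector [exp_int (u$1), gauss_int (u$2), exp_gauss_int (u$1) + gauss_exp_int (u$2)]"

definition surf' :: "real^2 \<Rightarrow> real^2 \<Rightarrow> real^3" where
  "surf' u v = vector [exp ((u$1)\<^sup>2) * v$1, exp (- ((u$2)\<^sup>2)) * v$2,
     exp ((u$1)\<^sup>2) * gauss_int (u$1) * v$1 + exp (- ((u$2)\<^sup>2)) * exp_int (u$2) * v$2]"

text \<open>The induced connection in the chart. Its only nonzero coefficients are the logarithmic
  derivatives of exp(u_1^2) and exp(-u_2^2).\<close>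

definition surf_conn :: "real^2 \<Rightarrow> real^2 \<Rightarrow> real^2 \<Rightarrow> real^2" where
  "surf_conn u v w = vector [2 * u$1 * (v$1 * w$1), - (2 * u$2 * (v$2 * w$2))]"

lemmas [derivative_intros] = bounded_linear.has_derivative[OF bounded_linear_vec_nth]

lemma inner_real_2: "v \<bullet> w = v$1 * w$1 + v$2 * w$2" for v w :: "real^2"
  by (simp add: inner_vec_def sum_2)

lemma calabi_field_nth [simp]:
  "calabi_field u $ 1 = 0" "calabi_field u $ 2 = 0" "calabi_field u $ 3 = 1"
  by (simp_all add: calabi_field_def)

lemma surf_has_derivative: "(surf has_derivative surf' u) (at u)"
proof (rule has_derivative_vec)
  have "\<forall>i. ((\<lambda>u. surf u $ i) has_derivative (\<lambda>v. surf' u v $ i)) (at u)"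
    unfolding forall_3 surf_def surf'_def vector_3
    by (auto intro!: derivative_eq_intros simp: algebra_simps)
  then show "((\<lambda>u. surf u $ i) has_derivative (\<lambda>v. surf' u v $ i)) (at u)" for i ..
qed

text \<open>This is the Gauss formula for constant fields. In the third component the outer
  exponential differentiates to the connection term, while differentiating the inner integral yields
  exp(u^2) exp(-u^2) = 1, which is the metric coefficient.\<close>

lemma surf'_has_derivative:
  "((\<lambda>u. surf' u w) has_derivative
     (\<lambda>v. surf' u (surf_conn u v w) + (v \<bullet> w) *\<^sub>R calabi_field u)) (at u)"
proof (rule has_derivative_vec)
  have "\<forall>i. ((\<lambda>u. surf' u w $ i) has_derivative
     (\<lambda>v. (surf' u (surf_conn u v w) + (v \<bullet> w) *\<^sub>R calabi_field u) $ i)) (at u)"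
    unfolding forall_3 surf'_def surf_conn_def vector_3 vector_2 vector_add_component
      vector_scaleR_component calabi_field_nth inner_real_2
    by (intro conjI; (rule derivative_eq_intros refl)+)
      (auto simp: fun_eq_iff algebra_simps exp_minus)
  then show "((\<lambda>u. surf' u w $ i) has_derivative
     (\<lambda>v. (surf' u (surf_conn u v w) + (v \<bullet> w) *\<^sub>R calabi_field u) $ i)) (at u)" for i ..
qed

lemma frechet_surf [simp]: "frechet_derivative surf (at u) = surf' u"
  using frechet_derivative_at[OF surf_has_derivative] by simp

lemma dir_deriv_surf: "dir_deriv w surf = (\<lambda>u. surf' u w)"
  by (rule ext) (rule dir_deriv_eq[OF surf_has_derivative])

lemma smooth_map_surf: "smooth_map surf"
proof (rule smooth_map_componentwise)
  have "\<forall>i. smooth_term (\<lambda>u. surf u $ i)"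
    unfolding forall_3 surf_def vector_3
    by (intro conjI smooth_term_intros)
  then show "smooth_term (\<lambda>u. surf u $ i)" for i ..
qed

lemma linear_surf': "linear (surf' u)"
  using surf_has_derivative has_derivative_linear by blast

lemma inj_surf': "inj (surf' u)"
  by (rule injI) (auto simp: surf'_def vec_eq_iff forall_2 forall_3)

lemma calabi_field_not_tangent: "calabi_field u \<notin> range (surf' u)"
  by (auto simp: surf'_def vec_eq_iff forall_3)

lemma gauss_surf:
  "calabi_connection surf (\<lambda>_. w) u v = surf_conn u v w"
  "calabi_metric surf u v w = v \<bullet> w"
proof -
  have "dir_deriv v (dir_deriv w surf) u =
      frechet_derivative surf (at u) (surf_conn u v w) + (v \<bullet> w) *\<^sub>R calabi_field u"
    unfolding dir_deriv_surf frechet_surf by (rule dir_deriv_eq[OF surf'_has_derivative])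
  note * = gauss_formula[of surf u calabi_field, unfolded frechet_surf,
      OF linear_surf' inj_surf' calabi_field_not_tangent this[unfolded frechet_surf]]
  show "calabi_connection surf (\<lambda>_. w) u v = surf_conn u v w"
    "calabi_metric surf u v w = v \<bullet> w"
    by (simp_all add: calabi_connection_def calabi_metric_def *)
qed

lemma calabi_metric_surf: "calabi_metric surf = (\<lambda>_. inner)"
  by (simp add: fun_eq_iff gauss_surf)

lemma calabi_surface_surf: "calabi_surface surf"
  unfolding calabi_surface_def transversal_hypersurface_def immersion_def
  by (simp add: smooth_map_surf inj_surf' calabi_field_not_tangent calabi_metric_surf
      inner_product_form_inner)

lemma sum_Basis_real_2: "sum f (Basis :: (real^2) set) = f (axis 1 1) + f (axis 2 1)"
proof -
  have B: "(Basis :: (real^2) set) = {axis 1 1, axis 2 1}"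
    by (auto simp: Basis_vec_def UNIV_2)
  have "(axis 1 1 :: real^2) \<noteq> axis 2 1"
    by (simp add: axis_eq_axis)
  then show ?thesis unfolding B by simp
qed

lemma axis_real_2 [simp]:
  "axis 1 a $ (1::2) = (a::real)" "axis 1 a $ (2::2) = 0"
  "axis 2 a $ (1::2) = 0" "axis 2 a $ (2::2) = a"
  by (simp_all add: axis_def)

lemma linear_trace_real_2: "linear_trace L = L (axis 1 1) $ 1 + L (axis 2 1) $ (2::2)"
  by (simp add: linear_trace_def sum_Basis_real_2 inner_axis)

lemma bilinear_surf_conn: "bilinear (surf_conn u)"
  by (auto simp: bilinear_def linear_iff surf_conn_def vec_eq_iff forall_2 algebra_simps)

lemma calabi_tchebychev_surf: "calabi_tchebychev surf u = vector [u$1, - (u$2)]"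
proof -
  have "calabi_tchebychev surf u = (1 / real DIM(real^2)) *\<^sub>R (\<Sum>b\<in>Basis. surf_conn u b b)"
    unfolding calabi_tchebychev_def calabi_metric_surf
    by (rule tchebychev_inner[OF bilinear_surf_conn]) (rule gauss_surf)
  also have "\<dots> = vector [u$1, - (u$2)]"
    unfolding sum_Basis_real_2 by (simp add: surf_conn_def vec_eq_iff forall_2)
  finally show ?thesis .
qed

lemma calabi_tchebychev_norm_not_constant:
  "\<not> metric_norm (calabi_metric surf) (calabi_tchebychev surf) constant_on UNIV"
proof
  assume "metric_norm (calabi_metric surf) (calabi_tchebychev surf) constant_on UNIV"
  \<comment> \<open>The field vanishes at the origin and has norm 1 at the first unit
    vector.\<close>
  then have "metric_norm (calabi_metric surf) (calabi_tchebychev surf) 0 =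
      metric_norm (calabi_metric surf) (calabi_tchebychev surf) (axis 1 1)"
    by (auto simp: constant_on_def)
  then show False
    by (simp add: metric_norm_def calabi_metric_surf calabi_tchebychev_surf inner_real_2)
qed

section \<open>The surface as a graph and affine maximality\<close>

definition base_proj :: "real^2 \<Rightarrow> real^2" where
  "base_proj u = vector [exp_int (u$1), gauss_int (u$2)]"

lemma base_proj_has_derivative:
  "(base_proj has_derivative (\<lambda>v. vector [exp ((u$1)\<^sup>2) * v$1, exp (- ((u$2)\<^sup>2)) * v$2])) (at u)"
proof (rule has_derivative_vec)
  have "\<forall>i. ((\<lambda>u. base_proj u $ i) has_derivative
      (\<lambda>v. (vector [exp ((u$1)\<^sup>2) * v$1, exp (- ((u$2)\<^sup>2)) * v$2] :: real^2) $ i)) (at u)"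
    unfolding forall_2 base_proj_def vector_2 by (auto intro!: derivative_eq_intros)
  then show "((\<lambda>u. base_proj u $ i) has_derivative
      (\<lambda>v. (vector [exp ((u$1)\<^sup>2) * v$1, exp (- ((u$2)\<^sup>2)) * v$2] :: real^2) $ i)) (at u)" for i ..
qed

lemma inj_base_proj: "inj base_proj"
  by (rule injI) (simp add: base_proj_def vec_eq_iff forall_2 exp_int_eq_iff gauss_int_eq_iff)

lemma continuous_on_base_proj: "continuous_on S base_proj"
  by (intro continuous_at_imp_continuous_on ballI has_derivative_continuous[OF base_proj_has_derivative])

text \<open>The differential of \<open>base_proj\<close> is diagonal with positive entries, so its
  inverse has the reciprocal exponentials; injectivity makes \<open>inv base_proj\<close> a left
  inverse on the whole plane.\<close>

lemma inv_base_proj_has_derivative: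
  "(inv base_proj has_derivative (\<lambda>v. vector [exp (- ((u$1)\<^sup>2)) * v$1, exp ((u$2)\<^sup>2) * v$2]))
    (at (base_proj u))"
  by (rule has_derivative_inverse_strong[OF open_UNIV UNIV_I continuous_on_base_proj _ base_proj_has_derivative])
    (auto simp: inv_f_f[OF inj_base_proj] fun_eq_iff vec_eq_iff forall_2 simp flip: exp_add mult.assoc)

lemma open_image_base_proj: "open U \<Longrightarrow> open (base_proj ` U)"
  by (rule invariance_of_domain[OF continuous_on_base_proj]) (auto intro: inj_on_subset[OF inj_base_proj])

lemma inv_base_proj_comp_has_derivative:
  assumes "(f has_derivative f') (at u)"
  shows "((\<lambda>z. f (inv base_proj z)) has_derivative
    (\<lambda>v. f' (vector [exp (- ((u$1)\<^sup>2)) * v$1, exp ((u$2)\<^sup>2) * v$2]))) (at (base_proj u))"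
  by (rule has_derivative_compose[OF inv_base_proj_has_derivative]) (simp add: inv_f_f[OF inj_base_proj] assms)

text \<open>The hypothesis determines \<open>f\<close> only on the image of \<open>U\<close>, which
  is open by invariance of domain, so derivatives there are determined too. Pulling the third row of
  \<open>surf'\<close> back through the inverse projection cancels the exponentials and leaves the
  gradient (\<open>gauss_int\<close> of u_1, \<open>exp_int\<close> of u_2). A second pullback
  multiplies each derivative by the same exponential again.\<close>

lemma hessian_graph:
  assumes U: "open U" and f: "\<And>u. u \<in> U \<Longrightarrow> surf u $ 3 = f (base_proj u)" and u: "u \<in> U"
  shows "hessian f (base_proj u) = vector [vector [exp (- (2 * (u$1)\<^sup>2)), 0],
    vector [0, exp (2 * (u$2)\<^sup>2)]]"
proof -
  have eq: "surf (inv base_proj z) $ 3 = f z" if "z \<in> base_proj ` U" for z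
    using that f by (auto simp: inv_f_f[OF inj_base_proj])
  have D: "(f has_derivative (\<lambda>v. gauss_int (p$1) * v$1 + exp_int (p$2) * v$2)) (at (base_proj p))"
    if "p \<in> U" for p
  proof (rule has_derivative_transform_within_open[OF _ open_image_base_proj[OF U] imageI[OF that] eq])
    have "((\<lambda>u. surf u $ 3) has_derivative (\<lambda>v. surf' p v $ 3)) (at p)"
      by (intro derivative_intros surf_has_derivative)
    from inv_base_proj_comp_has_derivative[OF this]
    show "((\<lambda>z. surf (inv base_proj z) $ 3) has_derivative
        (\<lambda>v. gauss_int (p$1) * v$1 + exp_int (p$2) * v$2)) (at (base_proj p))"
      by (simp add: surf'_def algebra_simps exp_minus)
  qed
  \<comment> \<open>The first derivatives are written as functions of the base point through
    \<open>inv base_proj\<close>, so that they can be differentiated once more.\<close>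
  then have 1: "gauss_int (inv base_proj z $ 1) * w$1 + exp_int (inv base_proj z $ 2) * w$2 = dir_deriv w f z"
    if "z \<in> base_proj ` U" for z w
    using that by (auto simp: inv_f_f[OF inj_base_proj] dir_deriv_eq[OF D])
  have 2: "(dir_deriv w f has_derivative
      (\<lambda>v. exp (- (2 * (u$1)\<^sup>2)) * v$1 * w$1 + exp (2 * (u$2)\<^sup>2) * v$2 * w$2)) (at (base_proj u))" for w
  proof (rule has_derivative_transform_within_open[OF _ open_image_base_proj[OF U] imageI[OF u] 1])
    have "((\<lambda>u. gauss_int (u$1) * w$1 + exp_int (u$2) * w$2) has_derivative
        (\<lambda>v. exp (- ((u$1)\<^sup>2)) * v$1 * w$1 + exp ((u$2)\<^sup>2) * v$2 * w$2)) (at u)"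
      by (auto intro!: derivative_eq_intros simp: algebra_simps)
    from inv_base_proj_comp_has_derivative[OF this]
    show "((\<lambda>z. gauss_int (inv base_proj z $ 1) * w$1 + exp_int (inv base_proj z $ 2) * w$2) has_derivative
      (\<lambda>v. exp (- (2 * (u$1)\<^sup>2)) * v$1 * w$1 + exp (2 * (u$2)\<^sup>2) * v$2 * w$2)) (at (base_proj u))"
      by (simp flip: exp_add mult.assoc)
  qed
  show ?thesis
    by (simp add: hessian_def dir_deriv_eq[OF 2] vec_eq_iff forall_2)
qed

lemma calabi_affine_maximal_surf: "calabi_affine_maximal surf"
  unfolding calabi_affine_maximal_def
proof (intro conjI allI impI ballI)
  fix U u and f :: "real^2 \<Rightarrow> real"
  assume "open U \<and> (\<forall>u\<in>U. surf u $ 3 = f (vector [surf u $ 1, surf u $ 2]))" and u: "u \<in> U"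
  then have U: "open U" and f: "\<And>u. u \<in> U \<Longrightarrow> surf u $ 3 = f (base_proj u)"
    by (auto simp: surf_def base_proj_def)
  have base: "vector [surf p $ 1, surf p $ 2] = base_proj p" for p
    by (simp add: surf_def base_proj_def)
  \<comment> \<open>The Hessian determinant is exp(2 u_2^2 - 2 u_1^2). Its logarithm is a quadratic
    with this gradient, which is linear and has trace zero.\<close>
  define grad where "grad p = (vector [- 4 * p$1, 4 * p$2] :: real^2)" for p :: "real^2"
  have "laplacian (\<lambda>_. inner) (\<lambda>p. ln (det (hessian f (base_proj p)))) u = linear_trace grad"
  proof (rule laplacian_inner[OF U u])
    fix p assume p: "p \<in> U"
    have "((\<lambda>p. 2 * (p$2)\<^sup>2 - 2 * (p$1)\<^sup>2) has_derivative (\<lambda>v. grad p \<bullet> v)) (at p)"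
      by (auto intro!: derivative_eq_intros simp: grad_def inner_real_2)
    then show "((\<lambda>p. ln (det (hessian f (base_proj p)))) has_derivative (\<lambda>v. grad p \<bullet> v)) (at p)"
      by (rule has_derivative_transform_within_open[OF _ U p])
        (simp add: hessian_graph[OF U f] det_2 flip: exp_add)
  next
    have "linear grad"
      by (auto simp: linear_iff grad_def vec_eq_iff forall_2 algebra_simps)
    then show "(grad has_derivative grad) (at u)"
      by (simp add: linear_imp_has_derivative)
  qed
  then show "laplacian (calabi_metric surf)
      (\<lambda>p. ln (det (hessian f (vector [surf p $ 1, surf p $ 2])))) u = 0"
    by (simp add: base calabi_metric_surf linear_trace_real_2 grad_def)
qed (rule calabi_surface_surf)

section \<open>Euclidean completeness of the surface\<close>

lemma Cauchy_if_dist_le: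
  fixes s :: "nat \<Rightarrow> 'a::metric_space" and f :: "nat \<Rightarrow> 'b::metric_space"
  assumes f: "Cauchy f" and le: "\<And>m n. k * dist (s m) (s n) \<le> dist (f m) (f n)" and k: "k > 0"
  shows "Cauchy s"
  unfolding Cauchy_def
proof (intro allI impI)
  fix e :: real assume "e > 0"
  with k have "k * e > 0" by simp
  then obtain M where "\<forall>m\<ge>M. \<forall>n\<ge>M. dist (f m) (f n) < k * e"
    using f unfolding Cauchy_def by blast
  then show "\<exists>M. \<forall>m\<ge>M. \<forall>n\<ge>M. dist (s m) (s n) < e"
    using le k by (meson mult_less_cancel_left_pos order_le_less_trans)
qed

text \<open>The first parameter is controlled directly, as \<open>exp_int\<close> does not contract
  distances. For the second, the bounded third component first confines the parameter through its
  logarithmic growth; on that bounded range \<open>gauss_int\<close> expands distances up to a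
  positive constant.\<close>

lemma Cauchy_surf_imp_Cauchy:
  assumes s: "Cauchy (\<lambda>n::nat. surf (s n))"
  shows "Cauchy s"
proof -
  have comp: "Cauchy (\<lambda>n. surf (s n) $ i)" for i
    using s by (rule Cauchy_vec_nth)
  have "Cauchy (\<lambda>n. s n $ 1)"
    using comp[of 1] by (rule Cauchy_if_dist_le[where k = 1])
      (use exp_int_expanding in \<open>auto simp: surf_def dist_real_def\<close>)
  moreover have "Cauchy (\<lambda>n. s n $ 2)"
  proof -
    obtain M where M: "\<And>n. \<bar>surf (s n) $ 3\<bar> \<le> M"
      using Cauchy_Bseq[OF comp[of 3]] by (auto simp: Bseq_def)
    have R: "\<bar>s n $ 2\<bar> \<le> sqrt (exp (4 * M))" for n
    proof -
      have "ln (1 + (s n $ 2)\<^sup>2) / 4 \<le> surf (s n) $ 3"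
        using exp_gauss_int_nonneg[of "s n $ 1"] gauss_exp_int_ge_ln[of "s n $ 2"]
        by (simp add: surf_def)
      then have "ln (1 + (s n $ 2)\<^sup>2) \<le> 4 * M"
        using M[of n] by linarith
      then have "1 + (s n $ 2)\<^sup>2 \<le> exp (4 * M)"
        by (metis add_pos_nonneg exp_le_cancel_iff exp_ln zero_le_power2 zero_less_one)
      then show ?thesis
        by (intro real_le_rsqrt) simp
    qed
    show ?thesis
      using comp[of 2] by (rule Cauchy_if_dist_le)
        (use gauss_int_expanding[OF R R] in \<open>auto simp: surf_def dist_real_def\<close>)
  qed
  ultimately have "\<forall>i. Cauchy (\<lambda>n. s n $ i)" by (simp add: forall_2)
  then show ?thesis by (intro vec_CauchyI) blast
qed

text \<open>Supplies the continuous factor \<open>C\<close> for \<open>complete_metricI\<close>, by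
  bounding the Euclidean norm by the sum of the absolute components.\<close>

lemma norm_surf'_le:
  "norm (surf' u v) \<le> (exp ((u$1)\<^sup>2) + exp (- ((u$2)\<^sup>2)) + exp ((u$1)\<^sup>2) * \<bar>gauss_int (u$1)\<bar> +
     exp (- ((u$2)\<^sup>2)) * \<bar>exp_int (u$2)\<bar>) * norm v"
proof -
  have v: "\<bar>v $ i\<bar> \<le> norm v" for i by (rule component_le_norm_cart)
  have "norm (surf' u v) \<le> (\<Sum>i\<in>UNIV. \<bar>surf' u v $ i\<bar>)" by (rule norm_le_l1_cart)
  also have "\<dots> \<le> exp ((u$1)\<^sup>2) * \<bar>v$1\<bar> + exp (- ((u$2)\<^sup>2)) * \<bar>v$2\<bar> +
      (exp ((u$1)\<^sup>2) * \<bar>gauss_int (u$1)\<bar> * \<bar>v$1\<bar> + exp (- ((u$2)\<^sup>2)) * \<bar>exp_int (u$2)\<bar> * \<bar>v$2\<bar>)"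
    by (simp add: sum_3 surf'_def abs_mult order_trans[OF abs_triangle_ineq])
  also have "\<dots> \<le> exp ((u$1)\<^sup>2) * norm v + exp (- ((u$2)\<^sup>2)) * norm v +
      (exp ((u$1)\<^sup>2) * \<bar>gauss_int (u$1)\<bar> * norm v + exp (- ((u$2)\<^sup>2)) * \<bar>exp_int (u$2)\<bar> * norm v)"
    by (intro add_mono mult_left_mono v) auto
  finally show ?thesis by (simp add: algebra_simps)
qed

lemma euclidean_complete_surf: "euclidean_complete surf"
  unfolding euclidean_complete_def frechet_surf
proof (intro allI impI)
  fix B :: "real^3 \<Rightarrow> real^3 \<Rightarrow> real"
  assume B: "inner_product_form B"
  obtain c K where cK: "c > 0" "K > 0" "\<And>v. c * norm v \<le> sqrt (B v v)"
    "\<And>v. sqrt (B v v) \<le> K * norm v"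
    using inner_product_form_bounds[OF B] by blast
  have "bounded_bilinear B"
    using B by (simp add: inner_product_form_def bilinear_conv_bounded_bilinear)
  then interpret bounded_bilinear B .
  have cont: "continuous_on UNIV (\<lambda>u. surf' u v)" for v
    by (intro continuous_at_imp_continuous_on ballI has_derivative_continuous[OF surf'_has_derivative])
  \<comment> \<open>Scaling \<open>surf\<close> by \<open>c\<close> makes the norm of its
    differential at most the length given by \<open>B\<close>; the upper constant \<open>K\<close>
    enters the bound on chart segments.\<close>
  show "complete_metric (\<lambda>u v w. B (surf' u v) (surf' u w))"
  proof (rule complete_metricI[where F = "\<lambda>u. c *\<^sub>R surf u" and F' = "\<lambda>u v. c *\<^sub>R surf' u v" and
      C = "\<lambda>u. K * (exp ((u$1)\<^sup>2) + exp (- ((u$2)\<^sup>2)) + exp ((u$1)\<^sup>2) * \<bar>gauss_int (u$1)\<bar> +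
        exp (- ((u$2)\<^sup>2)) * \<bar>exp_int (u$2)\<bar>)"])
    show "((\<lambda>u. c *\<^sub>R surf u) has_derivative (\<lambda>v. c *\<^sub>R surf' u v)) (at u)" for u
      by (intro derivative_intros surf_has_derivative)
    show "norm (c *\<^sub>R surf' u v) \<le> sqrt (B (surf' u v) (surf' u v))" for u v
      using cK by simp
    show "continuous_on UNIV (\<lambda>u. B (surf' u v) (surf' u v))" for v
      by (intro continuous_on cont)
    show "sqrt (B (surf' u v) (surf' u v)) \<le> K * (exp ((u$1)\<^sup>2) + exp (- ((u$2)\<^sup>2)) +
        exp ((u$1)\<^sup>2) * \<bar>gauss_int (u$1)\<bar> + exp (- ((u$2)\<^sup>2)) * \<bar>exp_int (u$2)\<bar>) * norm v" for u v
      using order_trans[OF cK(4) mult_left_mono[OF norm_surf'_le less_imp_le[OF cK(2)]]]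
      by (simp add: mult.assoc)
    show "continuous_on UNIV (\<lambda>u::real^2. K * (exp ((u$1)\<^sup>2) + exp (- ((u$2)\<^sup>2)) +
        exp ((u$1)\<^sup>2) * \<bar>gauss_int (u$1)\<bar> + exp (- ((u$2)\<^sup>2)) * \<bar>exp_int (u$2)\<bar>))"
      by (intro continuous_intros)
    show "Cauchy s" if "Cauchy (\<lambda>n::nat. c *\<^sub>R surf (s n))" for s
      by (rule Cauchy_surf_imp_Cauchy, rule Cauchy_if_dist_le[OF that, of c])
        (use cK in \<open>auto simp: dist_norm simp flip: scaleR_diff_right\<close>)
  qed
qed

subsection \<open>The type II Calabi product with a point\<close>

definition product_surf :: "real \<times> (real^2) \<Rightarrow> real^4" where
  "product_surf p = vector [exp (fst p), exp (fst p) * surf (snd p) $ 1, exp (fst p) * surf (snd p) $ 2,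
     exp (fst p) * surf (snd p) $ 3 + fst p * exp (fst p)]"

definition product_surf' :: "real \<times> (real^2) \<Rightarrow> real \<times> (real^2) \<Rightarrow> real^4" where
  "product_surf' p v = vector
     [exp (fst p) * fst v,
      exp (fst p) * (surf (snd p) $ 1 * fst v + surf' (snd p) (snd v) $ 1),
      exp (fst p) * (surf (snd p) $ 2 * fst v + surf' (snd p) (snd v) $ 2),
      exp (fst p) * ((surf (snd p) $ 3 + fst p + 1) * fst v + surf' (snd p) (snd v) $ 3)]"

definition product_conn ::
  "real \<times> (real^2) \<Rightarrow> real \<times> (real^2) \<Rightarrow> real \<times> (real^2) \<Rightarrow> real \<times> (real^2)" where
  "product_conn p v w = (2 * (fst v * fst w) + snd v \<bullet> snd w,
     fst v *\<^sub>R snd w + fst w *\<^sub>R snd v + surf_conn (snd p) (snd v) (snd w))"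

lemma sum_Basis_prod:
  "sum f (Basis :: ('a::euclidean_space \<times> 'b::euclidean_space) set) =
     (\<Sum>i\<in>Basis. f (i, 0)) + (\<Sum>i\<in>Basis. f (0, i))"
proof -
  have "inj_on (\<lambda>u. (u::'a, 0::'b)) Basis" "inj_on (\<lambda>u. (0::'a, u::'b)) Basis"
    by (auto intro: inj_onI)
  then show ?thesis
    unfolding Basis_prod_def
    by (subst sum.union_disjoint) (auto simp: sum.reindex)
qed

lemma product_surf_has_derivative: "(product_surf has_derivative product_surf' p) (at p)"
proof (rule has_derivative_vec)
  have "\<forall>i. ((\<lambda>p. product_surf p $ i) has_derivative (\<lambda>v. product_surf' p v $ i)) (at p)"
    unfolding forall_4 product_surf_def product_surf'_def vector_4
    by (intro conjI; (rule derivative_eq_intros has_derivative_compose[OF _ surf_has_derivative] refl)+)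
      (auto simp: fun_eq_iff algebra_simps)
  then show "((\<lambda>p. product_surf p $ i) has_derivative (\<lambda>v. product_surf' p v $ i)) (at p)" for i ..
qed

text \<open>This is the Gauss formula with transversal field -y. Subscripts denoting derivatives,
  y_tt = 2 y_t - y, the mixed derivatives of y in t and u_i are y_i, and in y_ij the Calabi
  direction scaled by exp t equals y_t - y. Hence each unit of the Calabi metric contributes one to
  the t-component of the connection and one to the centroaffine metric.\<close>

lemma product_surf'_has_derivative:
  "((\<lambda>p. product_surf' p w) has_derivative
     (\<lambda>v. product_surf' p (product_conn p v w) + (v \<bullet> w) *\<^sub>R - product_surf p)) (at p)"
proof (rule has_derivative_vec)
  have lin: "surf' u (a + b) = surf' u a + surf' u b" "surf' u (c *\<^sub>R a) = c *\<^sub>R surf' u a" for u a b c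
    using linear_surf' by (auto simp: linear_iff)
  have "\<forall>i. ((\<lambda>p. product_surf' p w $ i) has_derivative
     (\<lambda>v. (product_surf' p (product_conn p v w) + (v \<bullet> w) *\<^sub>R - product_surf p) $ i)) (at p)"
    unfolding forall_4 product_surf_def product_surf'_def product_conn_def vector_4 vector_add_component
      vector_scaleR_component fst_conv snd_conv vector_uminus_component vector_4 lin
    by (intro conjI; (rule derivative_eq_intros has_derivative_compose[OF _ surf_has_derivative]
          has_derivative_compose[OF _ surf'_has_derivative] refl)+)
      (auto simp: fun_eq_iff algebra_simps inner_prod_def)
  then show "((\<lambda>p. product_surf' p w $ i) has_derivative
     (\<lambda>v. (product_surf' p (product_conn p v w) + (v \<bullet> w) *\<^sub>R - product_surf p) $ i)) (at p)" for i ..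
qed

lemma frechet_product_surf [simp]: "frechet_derivative product_surf (at p) = product_surf' p"
  using frechet_derivative_at[OF product_surf_has_derivative] by simp

lemma dir_deriv_product_surf: "dir_deriv w product_surf = (\<lambda>p. product_surf' p w)"
  by (rule ext) (rule dir_deriv_eq[OF product_surf_has_derivative])

lemma smooth_map_product_surf: "smooth_map product_surf"
proof (rule smooth_map_componentwise)
  have "\<forall>i. smooth_term (\<lambda>p. product_surf p $ i)"
    unfolding forall_4 product_surf_def surf_def vector_3 vector_4
    by (intro conjI smooth_term_intros)
  then show "smooth_term (\<lambda>p. product_surf p $ i)" for i ..
qed

lemma linear_product_surf': "linear (product_surf' p)"
  using product_surf_has_derivative has_derivative_linear by blast

lemma inj_product_surf': "inj (product_surf' p)"
  unfolding linear_injective_0[OF linear_product_surf']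
  by (auto simp: product_surf'_def surf'_def vec_eq_iff forall_2 forall_4 vector_4 prod_eq_iff)

text \<open>If y were a tangent image, the first component would force the t-part of the vector to
  be 1, and the next two would force its u-part to vanish. The last component then fails by the
  extra 1 that comes from differentiating t exp(t).\<close>

lemma product_surf_not_tangent: "product_surf p \<notin> range (product_surf' p)"
  by (auto simp: product_surf_def product_surf'_def surf'_def vec_eq_iff forall_4 vector_4 algebra_simps)

lemma gauss_product_surf:
  "centroaffine_connection 1 product_surf (\<lambda>_. w) p v = product_conn p v w"
  "centroaffine_metric 1 product_surf p v w = v \<bullet> w"
proof -
  have eq: "dir_deriv v (dir_deriv w product_surf) p =
      product_surf' p (product_conn p v w) + (v \<bullet> w) *\<^sub>R ((- 1) *\<^sub>R product_surf p)"
    unfolding dir_deriv_product_surf using dir_deriv_eq[OF product_surf'_has_derivative] by simp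
  \<comment> \<open>The Gauss formula for elliptic type uses -y, so transversality of y is
    transferred by linearity.\<close>
  have "(- 1) *\<^sub>R product_surf p \<notin> range (product_surf' p)"
  proof
    assume "(- 1) *\<^sub>R product_surf p \<in> range (product_surf' p)"
    then obtain v where "- product_surf p = product_surf' p v" by auto
    then have "product_surf p = product_surf' p (- v)"
      by (metis linear_neg[OF linear_product_surf'] minus_equation_iff)
    then show False using product_surf_not_tangent by blast
  qed
  note * = gauss_formula[of product_surf p "\<lambda>p. (- 1) *\<^sub>R product_surf p", unfolded frechet_product_surf,
      OF linear_product_surf' inj_product_surf' this eq]
  show "centroaffine_connection 1 product_surf (\<lambda>_. w) p v = product_conn p v w"
    "centroaffine_metric 1 product_surf p v w = v \<bullet> w"
    using * by (simp_all add: centroaffine_connection_def centroaffine_metric_def)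
qed

lemma centroaffine_metric_product_surf: "centroaffine_metric 1 product_surf = (\<lambda>_. inner)"
  by (simp add: fun_eq_iff gauss_product_surf)

lemma centroaffine_hypersurface_product_surf: "centroaffine_hypersurface 1 product_surf"
  unfolding centroaffine_hypersurface_def transversal_hypersurface_def immersion_def
  by (simp add: smooth_map_product_surf inj_product_surf' product_surf_not_tangent centroaffine_metric_product_surf
      inner_product_form_inner)

lemma bilinear_product_conn: "bilinear (product_conn p)"
  by (auto simp: bilinear_def linear_iff product_conn_def surf_conn_def vec_eq_iff forall_2
      inner_real_2 algebra_simps)

text \<open>In the t-component of the trace the t-direction contributes 2 and each u-direction 1,
  which gives 4; the u-component is the trace of \<open>surf_conn\<close>.\<close>

lemma centroaffine_tchebychev_product_surf:
  "centroaffine_tchebychev 1 product_surf p =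
     (1/3) *\<^sub>R (4, vector [2 * snd p $ 1, - (2 * snd p $ 2)])"
proof -
  have "tchebychev (centroaffine_connection 1 product_surf) (\<lambda>_. inner) p =
      (1 / real DIM(real \<times> (real^2))) *\<^sub>R (\<Sum>b\<in>Basis. product_conn p b b)"
    by (rule tchebychev_inner[OF bilinear_product_conn]) (rule gauss_product_surf)
  then show ?thesis
    by (simp add: centroaffine_tchebychev_def centroaffine_metric_product_surf sum_Basis_prod
        sum_Basis_real_2 product_conn_def surf_conn_def inner_real_2 vec_eq_iff forall_2)
qed

lemma centroaffine_extremal_product_surf: "centroaffine_extremal 1 product_surf"
  unfolding centroaffine_extremal_def
proof (intro conjI allI)
  fix p
  \<comment> \<open>The Tchebychev field is affine with linear part \<open>L\<close>, so its
    divergence is the trace of \<open>L\<close>, in which 2/3 and -2/3 cancel.\<close>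
  define L where "L v = (1/3) *\<^sub>R (0 :: real, vector [2 * snd v $ 1, - (2 * snd v $ 2)] :: real^2)"
    for v :: "real \<times> (real^2)"
  have "linear L"
    by (auto simp: linear_iff L_def vec_eq_iff forall_2 algebra_simps)
  then have "((\<lambda>p. (4/3, 0) + L p) has_derivative L) (at p)"
    by (auto intro!: derivative_eq_intros linear_imp_has_derivative)
  moreover have "centroaffine_tchebychev 1 product_surf = (\<lambda>p. (4/3, 0) + L p)"
    by (simp add: fun_eq_iff centroaffine_tchebychev_product_surf L_def)
  ultimately have "divergence (\<lambda>_. inner) (centroaffine_tchebychev 1 product_surf) p = linear_trace L"
    by (intro divergence_inner) simp
  also have "\<dots> = 0"
    by (simp add: linear_trace_def sum_Basis_prod sum_Basis_real_2 L_def inner_real_2)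
  finally show "divergence (centroaffine_metric 1 product_surf) (centroaffine_tchebychev 1 product_surf) p = 0"
    by (simp add: centroaffine_metric_product_surf)
qed (rule centroaffine_hypersurface_product_surf)

lemma centroaffine_tchebychev_norm_not_constant:
  "\<not> metric_norm (centroaffine_metric 1 product_surf) (centroaffine_tchebychev 1 product_surf) constant_on UNIV"
proof
  assume "metric_norm (centroaffine_metric 1 product_surf) (centroaffine_tchebychev 1 product_surf) constant_on UNIV"
  \<comment> \<open>The t-component 4/3 is common to both points; the u-component is zero at the
    first and nonzero at the second.\<close>
  then have "metric_norm (centroaffine_metric 1 product_surf) (centroaffine_tchebychev 1 product_surf) (0, 0) =
      metric_norm (centroaffine_metric 1 product_surf) (centroaffine_tchebychev 1 product_surf) (0, axis 1 1)"
    by (auto simp: constant_on_def)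
  then show False
    by (simp add: metric_norm_def centroaffine_metric_product_surf centroaffine_tchebychev_product_surf inner_real_2)
qed

theorem theorem1p2:
  fixes x :: "real^2 \<Rightarrow> real^3" and y :: "real \<times> (real^2) \<Rightarrow> real^4"
  assumes x: "\<And>u. x u = vector
      [LBINT t=0..u$1. exp (t^2),
       LBINT t=0..u$2. exp (- (t^2)),
       (LBINT t=0..u$1. exp (t^2) * (LBINT s=0..t. exp (- (s^2)))) +
       (LBINT t=0..u$2. exp (- (t^2)) * (LBINT s=0..t. exp (s^2)))]"
    and y: "\<And>t u. y (t, u) = vector
      [exp t, exp t * x u $ 1, exp t * x u $ 2, exp t * x u $ 3 + t * exp t]"
  shows
    "(calabi_affine_maximal x \<and>
      complete_metric (calabi_metric x) \<and>
      flat_metric (calabi_metric x) \<and>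
      euclidean_complete x \<and>
      \<not> metric_norm (calabi_metric x) (calabi_tchebychev x) constant_on UNIV) \<and>
     (elliptic_centroaffine_hypersurface y \<and>
      centroaffine_extremal 1 y \<and>
      complete_metric (centroaffine_metric 1 y) \<and>
      flat_metric (centroaffine_metric 1 y) \<and>
      \<not> metric_norm (centroaffine_metric 1 y) (centroaffine_tchebychev 1 y) constant_on UNIV)"
proof -
  have [simp]: "x = surf"
    by (rule ext) (simp add: x surf_def exp_int_def gauss_int_def exp_gauss_int_def
        gauss_exp_int_def)
  have [simp]: "y = product_surf"
    by (rule ext) (auto simp: y product_surf_def)
  \<comment> \<open>The metrics are replaced by the flat one only under
    \<open>complete_metric\<close> and \<open>flat_metric\<close>, so that the claims on norms keep
    the form in which they were proved.\<close>
  show ?thesis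
    by (simp add: calabi_affine_maximal_surf complete_metric_inner flat_metric_inner
        euclidean_complete_surf calabi_tchebychev_norm_not_constant centroaffine_hypersurface_product_surf
        centroaffine_extremal_product_surf centroaffine_tchebychev_norm_not_constant
        calabi_metric_surf[THEN arg_cong[where f = complete_metric]]
        calabi_metric_surf[THEN arg_cong[where f = flat_metric]]
        centroaffine_metric_product_surf[THEN arg_cong[where f = complete_metric]]
        centroaffine_metric_product_surf[THEN arg_cong[where f = flat_metric]])
qed

end
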